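(* Let $(A_0,A_1)$ be a compatible couple of quasi-normed spaces, let $0<\theta<1$ and $0<q\le\infty$, and let $b_0,b_1\in SV$ be such that $\rho=b_0/b_1$ is non-decreasing. Then, for all $f\in A_0+A_1$ and all $t>0$, $$K(\rho(t),f;\bar A_{\theta,q;b_0},\bar A_{\theta,q;b_1})\approx \|u^{-\theta-1/q}b_0(u)K(u,f;A_0,A_1)\|_{q,(0,t)}+\rho(t)\,\|u^{-\theta-1/q}b_1(u)K(u,f;A_0,A_1)\|_{q,(t,\infty)}.$$
   Context: Notation: $\|\cdot\|_{q,(a,b)}$ is the $L^q$-quasi-norm on $(a,b)$ with respect to Lebesgue measure ($1/q=0$ if $q=\infty$). $A\lesssim B$ means $A\le cB$ with a positive constant $c$ independent of the appropriate parameters (here independent of $f$ and $t$); $A\approx B$ means $A\lesssim B$ and $B\lesssim A$. Slowly varying functions: a Lebesgue measurable $b:(0,\infty)\to(0,\infty)$ is slowly varying, $b\in SV$, if for every $\varepsilon>0$ there are positive functions $g_\varepsilon$ (non-decreasing) and $g_{-\varepsilon}$ (non-increasing) on $(0,\infty)$ with $t^{\varepsilon}b(t)\approx g_\varepsilon(t)$ and $t^{-\varepsilon}b(t)\approx g_{-\varepsilon}(t)$ for all $t>0$. Compatible couple: quasi-normed spaces $A_0,A_1$ continuously embedded in the same Hausdorff topological vector space. For $f\in A_0+A_1$, $t>0$, $K(t,f;A_0,A_1)=\inf\{\|f_0\|_{A_0}+t\|f_1\|_{A_1}: f_0\in A_0,\ f_1\in A_1,\ f=f_0+f_1\}$, with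 the convention $\inf\emptyset=\infty$ when a $K$-functional is taken at an element outside the sum of the couple. For $0<q\le\infty$, $0\le\theta\le1$, $b\in SV$, $\bar A_{\theta,q;b}=(A_0,A_1)_{\theta,q;b}$ is the space of $f\in A_0+A_1$ with $\|f\|_{\bar A_{\theta,q;b}}=\|t^{-\theta-1/q}b(t)K(t,f;A_0,A_1)\|_{q,(0,\infty)}<\infty$. *)

theory Defs
  imports "HOL-Probability.Essential_Supremum"
begin

class topological_real_vector = real_vector + topological_ab_group_add +
  assumes tendsto_scaleR_Pair:
    "LIM p (nhds c \<times>\<^sub>F nhds x). fst p *\<^sub>R snd p :> nhds (c *\<^sub>R x)"

instance real_normed_vector \<subseteq> topological_real_vector
proof
  fix c :: real and x :: 'a
  show "LIM p (nhds c \<times>\<^sub>F nhds x). fst p *\<^sub>R snd p :> nhds (c *\<^sub>R x)"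
    by (intro tendsto_scaleR filterlim_fst filterlim_snd)
qed

text \<open>
  A quasi-normed space inside an ambient vector space \<open>'a\<close>; the value of \<open>qnorm\<close> outside
  \<open>vecs\<close> is irrelevant.
\<close>

record 'a qspace =
  vecs :: "'a set"
  qnorm :: "'a \<Rightarrow> real"

definition quasi_normed_space :: "'a::real_vector qspace \<Rightarrow> bool" where
  "quasi_normed_space A \<longleftrightarrow>
     subspace (vecs A) \<and>
     (\<forall>x\<in>vecs A. 0 \<le> qnorm A x) \<and>
     (\<forall>x\<in>vecs A. qnorm A x = 0 \<longleftrightarrow> x = 0) \<and>
     (\<forall>c. \<forall>x\<in>vecs A. qnorm A (c *\<^sub>R x) = \<bar>c\<bar> * qnorm A x) \<and>
     (\<exists>C\<ge>1. \<forall>x\<in>vecs A. \<forall>y\<in>vecs A. qnorm A (x + y) \<le> C * (qnorm A x + qnorm A y))"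

text \<open>
  Continuity of the inclusion map, for the topology on \<open>vecs A\<close> induced by the quasi-norm.
\<close>

definition continuously_embedded :: "'a::topological_real_vector qspace \<Rightarrow> bool" where
  "continuously_embedded A \<longleftrightarrow>
     (\<forall>x\<in>vecs A. \<forall>U. open U \<and> x \<in> U \<longrightarrow>
        (\<exists>\<delta>>0. \<forall>y\<in>vecs A. qnorm A (y - x) < \<delta> \<longrightarrow> y \<in> U))"

definition compatible_couple ::
    "'a::{topological_real_vector, t2_space} qspace \<Rightarrow> 'a qspace \<Rightarrow> bool" where
  "compatible_couple A0 A1 \<longleftrightarrow>
     quasi_normed_space A0 \<and> continuously_embedded A0 \<and>
     quasi_normed_space A1 \<and> continuously_embedded A1"

definition sum_space :: "'a::real_vector qspace \<Rightarrow> 'a qspace \<Rightarrow> 'a set" where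
  "sum_space A0 A1 = {f0 + f1 | f0 f1. f0 \<in> vecs A0 \<and> f1 \<in> vecs A1}"

text \<open>
  The \<open>K\<close>-functional takes values in \<open>[0, \<infinity>]\<close>, so that the infimum of the empty set is \<open>\<infinity>\<close>.
\<close>

definition K_functional ::
    "real \<Rightarrow> 'a::real_vector \<Rightarrow> 'a qspace \<Rightarrow> 'a qspace \<Rightarrow> ennreal" where
  "K_functional t f A0 A1 =
     Inf {ennreal (qnorm A0 f0 + t * qnorm A1 f1) | f0 f1.
            f0 \<in> vecs A0 \<and> f1 \<in> vecs A1 \<and> f = f0 + f1}"

text \<open>Powers with exponent \<open>p > 0\<close> on \<open>[0, \<infinity>]\<close>.\<close>

definition ennreal_power :: "ennreal \<Rightarrow> real \<Rightarrow> ennreal" where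
  "ennreal_power x p = (if x = \<infinity> then \<infinity> else ennreal (enn2real x powr p))"

text \<open>\<open>1 / q\<close> as a real number, equal to \<open>0\<close> for \<open>q = \<infinity>\<close>.\<close>

definition recip :: "ennreal \<Rightarrow> real" where
  "recip q = enn2real (1 / q)"

text \<open>
  The \<open>L\<^sup>q\<close>-quasi-norm over \<open>S\<close> of a nonnegative Lebesgue measurable function, for
  \<open>0 < q \<le> \<infinity>\<close>.
\<close>

definition Lq_norm :: "ennreal \<Rightarrow> real set \<Rightarrow> (real \<Rightarrow> ennreal) \<Rightarrow> ennreal" where
  "Lq_norm q S g =
     (if q = \<infinity> then esssup (lebesgue_on S) g
      else ennreal_power (\<integral>\<^sup>+u. ennreal_power (g u) (enn2real q) \<partial>lebesgue_on S) (recip q))"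

definition equiv_pos :: "(real \<Rightarrow> real) \<Rightarrow> (real \<Rightarrow> real) \<Rightarrow> bool" where
  "equiv_pos f g \<longleftrightarrow>
     (\<exists>c>0. \<forall>t>0. f t \<le> c * g t) \<and> (\<exists>c>0. \<forall>t>0. g t \<le> c * f t)"

text \<open>The values of a slowly varying function on \<open>(-\<infinity>, 0]\<close> are irrelevant.\<close>

definition slowly_varying :: "(real \<Rightarrow> real) \<Rightarrow> bool" where
  "slowly_varying b \<longleftrightarrow>
     b \<in> borel_measurable (lebesgue_on {0<..}) \<and>
     (\<forall>t>0. 0 < b t) \<and>
     (\<forall>\<epsilon>>0.
        (\<exists>g. (\<forall>t>0. 0 < g t) \<and> mono_on {0<..} g \<and> equiv_pos (\<lambda>t. t powr \<epsilon> * b t) g) \<and>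
        (\<exists>g. (\<forall>t>0. 0 < g t) \<and> antimono_on {0<..} g \<and> equiv_pos (\<lambda>t. t powr (-\<epsilon>) * b t) g))"

definition weighted_K ::
    "real \<Rightarrow> ennreal \<Rightarrow> (real \<Rightarrow> real) \<Rightarrow> 'a::real_vector qspace \<Rightarrow> 'a qspace \<Rightarrow> 'a \<Rightarrow> real \<Rightarrow> ennreal" where
  "weighted_K \<theta> q b A0 A1 f u =
     ennreal (u powr (-\<theta> - recip q) * b u) * K_functional u f A0 A1"

definition interp_space ::
    "real \<Rightarrow> ennreal \<Rightarrow> (real \<Rightarrow> real) \<Rightarrow> 'a::real_vector qspace \<Rightarrow> 'a qspace \<Rightarrow> 'a qspace" where
  "interp_space \<theta> q b A0 A1 =
     \<lparr>vecs = {f \<in> sum_space A0 A1. Lq_norm q {0<..} (weighted_K \<theta> q b A0 A1 f) < \<infinity>},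
      qnorm = (\<lambda>f. enn2real (Lq_norm q {0<..} (weighted_K \<theta> q b A0 A1 f)))\<rparr>"

end

theory Submission
  imports Defs
begin

text \<open>
  Write \<open>K u f\<close> for the \<open>K\<close>-functional of the couple \<open>(A0, A1)\<close> and \<open>N\<^sub>i\<close> for the weighted norm that
  defines the \<open>i\<close>-th interpolation space, so that \<open>\<rho> = b0 / b1\<close> and the claim concerns the infimum of
  \<open>N\<^sub>0 f0 + \<rho> t * N\<^sub>1 f1\<close> over all decompositions \<open>f = f0 + f1\<close>.

  The right-hand side is bounded by each such sum
  (\<open>weighted_norms_le_K_functional_interp_space\<close>). By the quasi-triangle inequality for \<open>K u\<close>, one has
  to estimate the contributions of \<open>f0\<close> and \<open>f1\<close> separately. On \<open>(0, t)\<close> the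
  weight \<open>b0 = \<rho> * b1\<close> is at most \<open>\<rho> t * b1\<close>, and on \<open>(t, \<infinity>)\<close> the weight \<open>\<rho> t * b1\<close> is at most \<open>b0\<close>,
  because \<open>\<rho>\<close> is non-decreasing. So each contribution is at most \<open>N\<^sub>0 f0\<close> or \<open>\<rho> t * N\<^sub>1 f1\<close>.

  For the converse (\<open>K_functional_interp_space_le_weighted_norms\<close>) one decomposition suffices for
  all scales: split \<open>f = f0 + f1\<close> in \<open>A0 + A1\<close> with cost \<open>e\<close> close to
  \<open>K t f\<close> at the given \<open>t\<close>. Then \<open>K u f0 \<le> e\<close> and
  \<open>K u f1 \<le> (u/t) * e\<close> for all \<open>u > 0\<close>. Hence \<open>K u f0\<close> is bounded by
  a multiple of \<open>K u f + (u/t) * e\<close>, which is used on \<open>(0, t)\<close>, and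
  \<open>K u f1\<close> by a multiple of \<open>K u f + e\<close>, which is used on
  \<open>(t, \<infinity>)\<close>. Since \<open>0 < \<theta> < 1\<close> and \<open>b\<close> varies slowly, the
  weighted norms of \<open>(u/t) * e\<close> on \<open>(0, t)\<close> and of \<open>e\<close> on
  \<open>(t, \<infinity>)\<close> are of order \<open>t powr (- \<theta>) * b t * e\<close>
  (\<open>slowly_varying_weight_below\<close>, \<open>slowly_varying_weight_above\<close>). As
  \<open>\<rho> t * b1 t = b0 t\<close>, the total error has order
  \<open>t powr (- \<theta>) * b0 t * K t f\<close>. This is controlled by the norm over \<open>(0, t)\<close>
  since \<open>K u f \<ge> (u/t) * K t f\<close> there (\<open>K_functional_le_weighted_norm_below\<close>).
\<close>

section \<open>Powers on the extended half-line\<close>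

lemma ennreal_power_ennreal:
  "0 \<le> x \<Longrightarrow> ennreal_power (ennreal x) p = ennreal (x powr p)"
  by (simp add: ennreal_power_def)

lemma ennreal_power_mono:
  assumes "0 < p" "x \<le> y"
  shows "ennreal_power x p \<le> ennreal_power y p"
proof (cases y)
  case (real b)
  with assms obtain a where "x = ennreal a" "0 \<le> a"
    by (cases x) (auto simp: top_unique)
  with real assms show ?thesis
    by (auto simp: ennreal_power_ennreal intro!: ennreal_leI powr_mono2)
qed (auto simp: ennreal_power_def)

lemma ennreal_power_cmult:
  assumes "0 < p" "0 < c"
  shows "ennreal_power (ennreal c * x) p = ennreal (c powr p) * ennreal_power x p"
proof (cases x)
  case (real a)
  with assms show ?thesis
    by (simp add: ennreal_power_ennreal powr_mult flip: ennreal_mult)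
next
  case top
  with assms show ?thesis
    by (simp add: ennreal_power_def ennreal_mult_top)
qed

text \<open>
  A substitute for convexity that works for every exponent \<open>p > 0\<close>: bound the sum by twice the
  larger of the two terms.
\<close>

lemma ennreal_power_add_le:
  assumes "0 < p"
  shows "ennreal_power (x + y) p \<le> ennreal (2 powr p) * (ennreal_power x p + ennreal_power y p)"
proof -
  have "x + y \<le> max x y + max x y"
    by (rule add_mono) auto
  also have "\<dots> = ennreal 2 * max x y"
    by (simp add: mult_2)
  finally have "ennreal_power (x + y) p \<le> ennreal_power (ennreal 2 * max x y) p"
    by (rule ennreal_power_mono[OF assms])
  also have "\<dots> = ennreal (2 powr p) * ennreal_power (max x y) p"
    by (simp only: ennreal_power_cmult[OF assms])
  also have "\<dots> \<le> ennreal (2 powr p) * (ennreal_power x p + ennreal_power y p)"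
    by (intro mult_left_mono) (auto simp: max_def)
  finally show ?thesis .
qed

lemma measurable_ennreal_power [measurable]:
  assumes [measurable]: "g \<in> borel_measurable M"
  shows "(\<lambda>u. ennreal_power (g u) p) \<in> borel_measurable M"
  unfolding ennreal_power_def by measurable

section \<open>The weighted quasi-norms of order q\<close>

lemma finite_exponent_cases:
  assumes "0 < q" "q \<noteq> \<infinity>"
  obtains p where "0 < p" "q = ennreal p" "recip q = 1 / p"
proof (cases q)
  case (real p)
  with assms have "0 < p" by auto
  with real have "recip q = 1 / p"
    by (simp add: recip_def divide_ennreal flip: ennreal_1)
  with real \<open>0 < p\<close> that show ?thesis by simp
qed (use assms in simp)

lemma recip_top [simp]: "recip top = 0"
  by (simp add: recip_def)

lemma Lq_norm_ennreal:
  assumes "0 < p"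
  shows "Lq_norm (ennreal p) S g
    = ennreal_power (\<integral>\<^sup>+u. ennreal_power (g u) p \<partial>lebesgue_on S) (1 / p)"
  using assms by (simp add: Lq_norm_def recip_def divide_ennreal flip: ennreal_1)

lemma Lq_norm_mono:
  assumes q: "0 < q" and g: "g \<in> borel_measurable (lebesgue_on S)"
    and le: "\<And>u. u \<in> S \<Longrightarrow> g u \<le> h u"
  shows "Lq_norm q S g \<le> Lq_norm q S h"
proof (cases "q = \<infinity>")
  case True
  with g le show ?thesis
    by (auto simp: Lq_norm_def intro!: esssup_AE_mono)
next
  case False
  with q obtain p where p: "0 < p" "q = ennreal p" by (rule finite_exponent_cases)
  with le show ?thesis
    by (auto simp: Lq_norm_ennreal intro!: ennreal_power_mono nn_integral_mono)
qed

lemma Lq_norm_zero: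
  assumes "0 < q"
  shows "Lq_norm q S (\<lambda>u. 0) = 0"
proof (cases "q = \<infinity>")
  case True
  have "esssup (lebesgue_on S) (\<lambda>u. 0 :: ennreal) \<le> 0"
    by (rule esssup_I) auto
  with True show ?thesis by (simp add: Lq_norm_def)
next
  case False
  with assms obtain p where p: "0 < p" "q = ennreal p" by (rule finite_exponent_cases)
  then show ?thesis by (simp add: Lq_norm_ennreal ennreal_power_def)
qed

lemma Lq_norm_cmult:
  assumes q: "0 < q" and g [measurable]: "g \<in> borel_measurable (lebesgue_on S)"
  shows "Lq_norm q S (\<lambda>u. ennreal c * g u) = ennreal c * Lq_norm q S g"
proof (cases "c > 0")
  case False
  then have "ennreal c = 0" by (simp add: ennreal_neg)
  then show ?thesis by (simp add: Lq_norm_zero[OF q])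
next
  case c: True
  show ?thesis
  proof (cases "q = \<infinity>")
    case True
    have le: "esssup (lebesgue_on S) (\<lambda>u. ennreal a * h u) \<le> ennreal a * esssup (lebesgue_on S) h"
      if [measurable]: "h \<in> borel_measurable (lebesgue_on S)" for a h
    proof (rule esssup_I)
      show "AE u in lebesgue_on S. ennreal a * h u \<le> ennreal a * esssup (lebesgue_on S) h"
        using esssup_AE[of h "lebesgue_on S"] by eventually_elim (rule mult_left_mono, auto)
    qed measurable
    have inv: "ennreal (1 / c) * (ennreal c * x) = x" "ennreal c * (ennreal (1 / c) * x) = x" for x
      using c by (simp_all flip: mult.assoc ennreal_mult)
    have "esssup (lebesgue_on S) g = esssup (lebesgue_on S) (\<lambda>u. ennreal (1 / c) * (ennreal c * g u))"
      by (simp only: inv)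
    also have "\<dots> \<le> ennreal (1 / c) * esssup (lebesgue_on S) (\<lambda>u. ennreal c * g u)"
      by (rule le) measurable
    finally have "ennreal c * esssup (lebesgue_on S) g
        \<le> ennreal c * (ennreal (1 / c) * esssup (lebesgue_on S) (\<lambda>u. ennreal c * g u))"
      by (rule mult_left_mono) simp
    with le[OF g, of c] True show ?thesis
      by (simp add: Lq_norm_def inv antisym)
  next
    case False
    with q obtain p where p: "0 < p" "q = ennreal p" by (rule finite_exponent_cases)
    have "c powr p > 0" using c by simp
    with p c show ?thesis
      by (simp add: Lq_norm_ennreal ennreal_power_cmult nn_integral_cmult powr_powr)
  qed
qed

text \<open>
  The constant \<open>2 powr (1 + 1/q)\<close> comes from applying \<open>ennreal_power_add_le\<close> twice, with exponent
  \<open>q\<close> inside the integral and \<open>1/q\<close> outside; the factors are \<open>2\<close> and \<open>2 powr (1/q)\<close>. It is far from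
  sharp, but it covers \<open>q < 1\<close>, \<open>q \<ge> 1\<close> and \<open>q = \<infinity>\<close> by a single formula.
\<close>

lemma Lq_norm_add:
  assumes q: "0 < q" and [measurable]: "g \<in> borel_measurable (lebesgue_on S)"
      "h \<in> borel_measurable (lebesgue_on S)"
  shows "Lq_norm q S (\<lambda>u. g u + h u)
    \<le> ennreal (2 powr (1 + recip q)) * (Lq_norm q S g + Lq_norm q S h)"
proof (cases "q = \<infinity>")
  case True
  have "esssup (lebesgue_on S) (\<lambda>u. g u + h u)
      \<le> esssup (lebesgue_on S) g + esssup (lebesgue_on S) h" (is "_ \<le> ?s")
  proof (rule esssup_I)
    show "AE u in lebesgue_on S. g u + h u \<le> ?s"
      using esssup_AE[of g "lebesgue_on S"] esssup_AE[of h "lebesgue_on S"]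
      by eventually_elim (rule add_mono)
  qed measurable
  also have "\<dots> = 1 * ?s" by simp
  also have "\<dots> \<le> ennreal (2 powr (1 + recip q)) * ?s"
    using True by (intro mult_right_mono) simp_all
  finally show ?thesis using True by (simp add: Lq_norm_def)
next
  case False
  with q obtain p where p: "0 < p" "q = ennreal p" "recip q = 1 / p" by (rule finite_exponent_cases)
  let ?I = "\<lambda>g. \<integral>\<^sup>+u. ennreal_power (g u) p \<partial>lebesgue_on S"
  have "?I (\<lambda>u. g u + h u)
      \<le> (\<integral>\<^sup>+u. ennreal (2 powr p) * (ennreal_power (g u) p + ennreal_power (h u) p) \<partial>lebesgue_on S)"
    by (intro nn_integral_mono ennreal_power_add_le p)
  also have "\<dots> = ennreal (2 powr p) * (?I g + ?I h)"
    by (simp add: nn_integral_cmult nn_integral_add)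
  finally have "Lq_norm q S (\<lambda>u. g u + h u)
      \<le> ennreal_power (ennreal (2 powr p) * (?I g + ?I h)) (1 / p)"
    using p by (simp add: Lq_norm_ennreal ennreal_power_mono)
  also have "\<dots> = ennreal 2 * ennreal_power (?I g + ?I h) (1 / p)"
    using ennreal_power_cmult[of "1 / p" "2 powr p"] p by (simp add: powr_powr)
  also have "\<dots> \<le> ennreal 2 * (ennreal (2 powr (1 / p)) * (Lq_norm q S g + Lq_norm q S h))"
    using ennreal_power_add_le[of "1 / p" "?I g" "?I h"] p
    by (intro mult_left_mono) (simp_all add: Lq_norm_ennreal)
  also have "\<dots> = ennreal (2 powr (1 + recip q)) * (Lq_norm q S g + Lq_norm q S h)"
    using p by (simp add: powr_add ennreal_mult mult.assoc)
  finally show ?thesis .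
qed

lemma Lq_norm_subset:
  assumes q: "0 < q" and sets: "S \<in> sets lebesgue" "T \<in> sets lebesgue" and sub: "S \<subseteq> T"
    and g: "g \<in> borel_measurable (lebesgue_on T)"
  shows "Lq_norm q S g \<le> Lq_norm q T g"
proof (cases "q = \<infinity>")
  case True
  have "esssup (lebesgue_on S) g \<le> esssup (lebesgue_on T) g"
  proof (rule esssup_I)
    show "g \<in> borel_measurable (lebesgue_on S)"
      using g sub by (rule measurable_restrict_mono)
    show "AE u in lebesgue_on S. g u \<le> esssup (lebesgue_on T) g"
      using esssup_AE[of g "lebesgue_on T"] sub sets
      by (auto simp: AE_restrict_space_iff)
  qed
  with True show ?thesis by (simp add: Lq_norm_def)
next
  case False
  with q obtain p where p: "0 < p" "q = ennreal p" by (rule finite_exponent_cases)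
  have "(\<integral>\<^sup>+u. ennreal_power (g u) p \<partial>lebesgue_on S)
      \<le> (\<integral>\<^sup>+u. ennreal_power (g u) p \<partial>lebesgue_on T)"
    using sets sub by (auto simp: nn_integral_restrict_space indicator_def intro!: nn_integral_mono)
  with p show ?thesis
    by (simp add: Lq_norm_ennreal ennreal_power_mono)
qed

lemma AE_lebesgue_neq: "AE u in lebesgue. u \<noteq> (t::real)"
  by (rule AE_completion) (rule AE_lborel_singleton)

text \<open>
  The endpoint \<open>t\<close> is missing on the right; it is a null set. The constant is chosen to match
  \<open>Lq_norm_add\<close>.
\<close>

lemma Lq_norm_split:
  assumes q: "0 < q" and t: "0 < t" and g [measurable]: "g \<in> borel_measurable (lebesgue_on {0<..})"
  shows "Lq_norm q {0<..} g
    \<le> ennreal (2 powr (1 + recip q)) * (Lq_norm q {0<..<t} g + Lq_norm q {t<..} g)"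
proof (cases "q = \<infinity>")
  case True
  let ?s = "esssup (lebesgue_on {0<..<t}) g + esssup (lebesgue_on {t<..}) g"
  have "esssup (lebesgue_on {0<..}) g \<le> ?s"
  proof (rule esssup_I)
    have "AE u in lebesgue. u \<in> {0<..<t} \<longrightarrow> g u \<le> esssup (lebesgue_on {0<..<t}) g"
      using esssup_AE[of g "lebesgue_on {0<..<t}"] by (simp add: AE_restrict_space_iff)
    moreover have "AE u in lebesgue. u \<in> {t<..} \<longrightarrow> g u \<le> esssup (lebesgue_on {t<..}) g"
      using esssup_AE[of g "lebesgue_on {t<..}"] by (simp add: AE_restrict_space_iff)
    ultimately have "AE u in lebesgue. u \<in> {0<..} \<longrightarrow> g u \<le> ?s"
      using AE_lebesgue_neq[of t]
      by eventually_elim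
        (use t in \<open>auto intro: add_increasing add_increasing2 simp: not_less_iff_gr_or_eq\<close>)
    then show "AE u in lebesgue_on {0<..}. g u \<le> ?s"
      by (simp add: AE_restrict_space_iff)
  qed (rule g)
  also have "\<dots> = 1 * ?s" by simp
  also have "\<dots> \<le> ennreal (2 powr (1 + recip q)) * ?s"
    using True by (intro mult_right_mono) simp_all
  finally show ?thesis using True by (simp add: Lq_norm_def)
next
  case False
  with q obtain p where p: "0 < p" "q = ennreal p" "recip q = 1 / p" by (rule finite_exponent_cases)
  let ?I = "\<lambda>S. \<integral>\<^sup>+u. ennreal_power (g u) p \<partial>lebesgue_on S"
  have m: "(\<lambda>u. ennreal_power (g u) p * indicator S u) \<in> borel_measurable lebesgue"
    if "S \<subseteq> {0<..}" "S \<in> sets lebesgue" for S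
  proof -
    have "(\<lambda>u. ennreal_power (g u) p) \<in> borel_measurable (lebesgue_on S)"
      by (rule measurable_restrict_mono[OF _ that(1)]) measurable
    then show ?thesis using that(2) by (simp add: borel_measurable_restrict_space_iff_ennreal)
  qed
  have "?I {0<..} = (\<integral>\<^sup>+u. ennreal_power (g u) p * indicator {0<..<t} u
        + ennreal_power (g u) p * indicator {t<..} u \<partial>lebesgue)"
    using AE_lebesgue_neq[of t]
    by (simp add: nn_integral_restrict_space, intro nn_integral_cong_AE, eventually_elim)
       (use t in \<open>auto simp: indicator_def\<close>)
  also have "\<dots> = ?I {0<..<t} + ?I {t<..}"
    using t by (subst nn_integral_add) (auto intro!: m simp: nn_integral_restrict_space)
  finally have "Lq_norm q {0<..} g = ennreal_power (?I {0<..<t} + ?I {t<..}) (1 / p)"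
    using p by (simp add: Lq_norm_ennreal)
  also have "\<dots> \<le> ennreal (2 powr (1 / p)) * (Lq_norm q {0<..<t} g + Lq_norm q {t<..} g)"
    using ennreal_power_add_le[of "1 / p" "?I {0<..<t}" "?I {t<..}"] p by (simp add: Lq_norm_ennreal)
  also have "\<dots> \<le> ennreal (2 powr (1 + recip q)) * (Lq_norm q {0<..<t} g + Lq_norm q {t<..} g)"
    using p by (intro mult_right_mono ennreal_leI powr_mono) auto
  finally show ?thesis .
qed

section \<open>Norms of power functions\<close>

lemma nn_integral_power_below:
  assumes "0 < a" "0 < t"
  shows "(\<integral>\<^sup>+u. ennreal (u powr (a - 1)) \<partial>lebesgue_on {0<..<t}) = ennreal (t powr a / a)"
proof -
  have "((\<lambda>u. u powr (a - 1)) has_integral (t powr a / a)) {0..t}"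
    using has_integral_powr_from_0[of "a - 1" t] assms by simp
  then have "((\<lambda>u. u powr (a - 1)) has_integral (t powr a / a)) {0<..<t}"
    by (simp add: has_integral_Icc_iff_Ioo)
  then have "(\<integral>\<^sup>+u. ennreal (u powr (a - 1)) * indicator {0<..<t} u \<partial>lborel) = ennreal (t powr a / a)"
    by (rule nn_integral_has_integral_lebesgue'[rotated]) simp
  then show ?thesis by (simp add: nn_integral_restrict_space nn_integral_completion)
qed

lemma nn_integral_power_above:
  assumes "0 < a" "0 < t"
  shows "(\<integral>\<^sup>+u. ennreal (u powr (- a - 1)) \<partial>lebesgue_on {t<..}) = ennreal (t powr (- a) / a)"
proof -
  have "((\<lambda>u. u powr (- a - 1)) has_integral (t powr (- a) / a)) {t..}"
    using has_integral_powr_to_inf[of "- a - 1" t] assms by simp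
  then have "(\<integral>\<^sup>+u. ennreal (u powr (- a - 1)) * indicator {t..} u \<partial>lborel) = ennreal (t powr (- a) / a)"
    by (rule nn_integral_has_integral_lebesgue'[rotated]) simp
  moreover have "(\<integral>\<^sup>+u. ennreal (u powr (- a - 1)) * indicator {t..} u \<partial>lborel)
      = (\<integral>\<^sup>+u. ennreal (u powr (- a - 1)) * indicator {t<..} u \<partial>lborel)"
    using AE_lborel_singleton[of t]
    by (intro nn_integral_cong_AE, eventually_elim) (auto simp: indicator_def)
  ultimately show ?thesis by (simp add: nn_integral_restrict_space nn_integral_completion)
qed

lemma measurable_power [measurable]:
  "(\<lambda>u. ennreal (u powr a)) \<in> borel_measurable (lebesgue_on S)"
  by (intro measurable_restrict_space1 measurable_completion) measurable

text \<open>
  The shift by \<open>1/q\<close> turns the norm into that of \<open>u\<^sup>s\<close> with respect to \<open>du/u\<close>, which is invariant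
  under dilations; this is why both bounds are multiples of \<open>t\<^sup>s\<close>.
  For \<open>q = \<infinity>\<close> the lower bound is read off on \<open>(t/2, t)\<close>, which has positive measure.
\<close>

lemma Lq_norm_power_below:
  assumes q: "0 < q" and s: "0 < s"
  obtains \<kappa> \<kappa>' where "0 < \<kappa>" "0 < \<kappa>'"
    "\<And>t. 0 < t \<Longrightarrow> ennreal (\<kappa>' * t powr s) \<le> Lq_norm q {0<..<t} (\<lambda>u. ennreal (u powr (s - recip q)))"
    "\<And>t. 0 < t \<Longrightarrow> Lq_norm q {0<..<t} (\<lambda>u. ennreal (u powr (s - recip q))) \<le> ennreal (\<kappa> * t powr s)"
proof (cases "q = \<infinity>")
  case True
  let ?g = "\<lambda>u. ennreal (u powr s)"
  have upper: "Lq_norm q {0<..<t} ?g \<le> ennreal (1 * t powr s)" if t: "0 < t" for t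
  proof -
    have "esssup (lebesgue_on {0<..<t}) ?g \<le> ennreal (1 * t powr s)"
      using s t by (intro esssup_I[OF measurable_power]) (auto intro!: AE_I2 ennreal_leI powr_mono2)
    with True show ?thesis by (simp add: Lq_norm_def)
  qed
  have lower: "ennreal ((1 / 2) powr s * t powr s) \<le> Lq_norm q {0<..<t} ?g" if t: "0 < t" for t
  proof -
    have "emeasure (lebesgue_on {t / 2<..<t}) (space (lebesgue_on {t / 2<..<t})) \<noteq> 0"
      using t by (simp add: emeasure_restrict_space)
    then have "ennreal ((1 / 2) powr s * t powr s) = Lq_norm q {t / 2<..<t} (\<lambda>u. ennreal ((1 / 2 * t) powr s))"
      using True t by (simp add: Lq_norm_def esssup_const powr_mult powr_divide)
    also have "\<dots> \<le> Lq_norm q {t / 2<..<t} ?g"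
      using s t by (intro Lq_norm_mono[OF q]) (auto intro!: ennreal_leI powr_mono2)
    also have "\<dots> \<le> Lq_norm q {0<..<t} ?g"
      using t by (intro Lq_norm_subset[OF q _ _ _ measurable_power]) auto
    finally show ?thesis .
  qed
  show ?thesis
    using that[of 1 "(1 / 2) powr s"] upper lower True by simp
next
  case False
  with q obtain p where p: "0 < p" "q = ennreal p" "recip q = 1 / p" by (rule finite_exponent_cases)
  have "Lq_norm q {0<..<t} (\<lambda>u. ennreal (u powr (s - recip q)))
      = ennreal ((1 / (s * p)) powr (1 / p) * t powr s)" if t: "0 < t" for t
  proof -
    have "(s - 1 / p) * p = s * p - 1" using p by (simp add: field_simps)
    then have "Lq_norm q {0<..<t} (\<lambda>u. ennreal (u powr (s - recip q)))
        = ennreal_power (\<integral>\<^sup>+u. ennreal (u powr (s * p - 1)) \<partial>lebesgue_on {0<..<t}) (1 / p)"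
      using p by (simp add: Lq_norm_ennreal ennreal_power_ennreal powr_powr)
    also have "\<dots> = ennreal ((t powr (s * p) / (s * p)) powr (1 / p))"
      using p s t by (simp add: nn_integral_power_below ennreal_power_ennreal)
    also have "(t powr (s * p) / (s * p)) powr (1 / p) = (1 / (s * p)) powr (1 / p) * t powr s"
      using p s t by (simp add: powr_divide powr_powr)
    finally show ?thesis .
  qed
  with that[of "(1 / (s * p)) powr (1 / p)" "(1 / (s * p)) powr (1 / p)"] p s show ?thesis by simp
qed

lemma Lq_norm_power_above:
  assumes q: "0 < q" and s: "0 < s"
  obtains \<kappa> where "0 < \<kappa>"
    "\<And>t. 0 < t \<Longrightarrow> Lq_norm q {t<..} (\<lambda>u. ennreal (u powr (- s - recip q))) \<le> ennreal (\<kappa> * t powr (- s))"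
proof (cases "q = \<infinity>")
  case True
  have "esssup (lebesgue_on {t<..}) (\<lambda>u. ennreal (u powr (- s))) \<le> ennreal (1 * t powr (- s))"
    if t: "0 < t" for t
    using s t by (intro esssup_I[OF measurable_power]) (auto intro!: AE_I2 ennreal_leI powr_mono2')
  with that[of 1] True show ?thesis by (simp add: Lq_norm_def)
next
  case False
  with q obtain p where p: "0 < p" "q = ennreal p" "recip q = 1 / p" by (rule finite_exponent_cases)
  have "Lq_norm q {t<..} (\<lambda>u. ennreal (u powr (- s - recip q)))
      = ennreal ((1 / (s * p)) powr (1 / p) * t powr (- s))" if t: "0 < t" for t
  proof -
    have "(- s - 1 / p) * p = - (s * p) - 1" using p by (simp add: field_simps)
    then have "Lq_norm q {t<..} (\<lambda>u. ennreal (u powr (- s - recip q)))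
        = ennreal_power (\<integral>\<^sup>+u. ennreal (u powr (- (s * p) - 1)) \<partial>lebesgue_on {t<..}) (1 / p)"
      using p by (simp add: Lq_norm_ennreal ennreal_power_ennreal powr_powr)
    also have "\<dots> = ennreal ((t powr (- (s * p)) / (s * p)) powr (1 / p))"
      using p s t by (simp add: nn_integral_power_above ennreal_power_ennreal)
    also have "(t powr (- (s * p)) / (s * p)) powr (1 / p) = (1 / (s * p)) powr (1 / p) * t powr (- s)"
      using p s t by (simp add: powr_divide powr_powr)
    finally show ?thesis .
  qed
  with that[of "(1 / (s * p)) powr (1 / p)"] p s show ?thesis by simp
qed

section \<open>Slowly varying weights\<close>

lemma slowly_varying_pos: "slowly_varying b \<Longrightarrow> 0 < t \<Longrightarrow> 0 < b t"
  by (simp add: slowly_varying_def)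

text \<open>
  The auxiliary monotone functions of the definition enter the proof only through this lemma and
  the next one: up to a constant, \<open>b\<close> is increasing after multiplication by \<open>t\<^sup>\<epsilon>\<close> and decreasing
  after division by \<open>t\<^sup>\<epsilon>\<close>.
\<close>

lemma slowly_varying_almost_increasing:
  assumes b: "slowly_varying b" and \<epsilon>: "0 < \<epsilon>"
  obtains c where "0 < c"
    "\<And>u t. 0 < u \<Longrightarrow> u \<le> t \<Longrightarrow> u powr \<epsilon> * b u \<le> c * (t powr \<epsilon> * b t)"
proof -
  from b \<epsilon> obtain g where g: "mono_on {0<..} g" "equiv_pos (\<lambda>t. t powr \<epsilon> * b t) g"
    unfolding slowly_varying_def by blast
  then obtain c1 c2 where c: "0 < c1" "\<And>t. 0 < t \<Longrightarrow> t powr \<epsilon> * b t \<le> c1 * g t"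
      "0 < c2" "\<And>t. 0 < t \<Longrightarrow> g t \<le> c2 * (t powr \<epsilon> * b t)"
    unfolding equiv_pos_def by blast
  have "u powr \<epsilon> * b u \<le> (c1 * c2) * (t powr \<epsilon> * b t)" if u: "0 < u" "u \<le> t" for u t
  proof -
    have "u powr \<epsilon> * b u \<le> c1 * g u" using c u by simp
    also have "\<dots> \<le> c1 * g t"
      using c u g(1) by (intro mult_left_mono) (auto simp: mono_on_def)
    also have "\<dots> \<le> c1 * (c2 * (t powr \<epsilon> * b t))"
      using c u by (intro mult_left_mono) auto
    finally show ?thesis by (simp add: mult.assoc)
  qed
  with c that[of "c1 * c2"] show ?thesis by simp
qed

lemma slowly_varying_almost_decreasing:
  assumes b: "slowly_varying b" and \<epsilon>: "0 < \<epsilon>"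
  obtains c where "0 < c"
    "\<And>u t. 0 < u \<Longrightarrow> u \<le> t \<Longrightarrow> t powr (- \<epsilon>) * b t \<le> c * (u powr (- \<epsilon>) * b u)"
proof -
  from b \<epsilon> obtain g where g: "antimono_on {0<..} g" "equiv_pos (\<lambda>t. t powr (- \<epsilon>) * b t) g"
    unfolding slowly_varying_def by blast
  then obtain c1 c2 where c: "0 < c1" "\<And>t. 0 < t \<Longrightarrow> t powr (- \<epsilon>) * b t \<le> c1 * g t"
      "0 < c2" "\<And>t. 0 < t \<Longrightarrow> g t \<le> c2 * (t powr (- \<epsilon>) * b t)"
    unfolding equiv_pos_def by blast
  have "t powr (- \<epsilon>) * b t \<le> (c1 * c2) * (u powr (- \<epsilon>) * b u)" if u: "0 < u" "u \<le> t" for u t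
  proof -
    have "t powr (- \<epsilon>) * b t \<le> c1 * g t" using c u by simp
    also have "\<dots> \<le> c1 * g u"
      using c u g(1) by (intro mult_left_mono) (auto simp: monotone_on_def)
    also have "\<dots> \<le> c1 * (c2 * (u powr (- \<epsilon>) * b u))"
      using c u by (intro mult_left_mono) auto
    finally show ?thesis by (simp add: mult.assoc)
  qed
  with c that[of "c1 * c2"] show ?thesis by simp
qed

lemma measurable_weight:
  assumes b: "slowly_varying b" and S: "S \<subseteq> {0<..}"
  shows "(\<lambda>u. ennreal (u powr a * b u)) \<in> borel_measurable (lebesgue_on S)"
proof -
  have [measurable]: "b \<in> borel_measurable (lebesgue_on S)"
    using b S by (auto simp: slowly_varying_def intro: measurable_restrict_mono)
  have [measurable]: "(\<lambda>u::real. u powr a) \<in> borel_measurable (lebesgue_on S)"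
    by (intro measurable_restrict_space1 measurable_completion) measurable
  show ?thesis by measurable
qed

lemma measurable_linear [measurable]:
  "(\<lambda>u::real. ennreal (u / t * e)) \<in> borel_measurable (lebesgue_on S)"
  by (intro measurable_restrict_space1 measurable_completion) measurable

text \<open>
  With \<open>s = 1 - \<theta>\<close>, the function under the norm is \<open>u powr (s - 1/q) * b u * e / t\<close>. Half of the power
  \<open>u\<^sup>s\<close> is spent to replace \<open>b u\<close> by \<open>b t\<close>, which leaves the positive exponent \<open>s/2\<close> for the norm of
  a pure power. For the lower bound \<open>b u\<close> is replaced by \<open>b t\<close> at the price of an extra factor
  \<open>(u/t)\<^sup>s\<close>, and the remaining exponent \<open>2 * s\<close> is again positive. The form
  \<open>u / t * e\<close> is the one in which the linear bounds for the \<open>K\<close>-functional appear below \<open>t\<close>.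
\<close>

lemma slowly_varying_weight_below:
  assumes b: "slowly_varying b" and q: "0 < q" and \<theta>: "\<theta> < 1"
  obtains c c' where "0 < c" "0 < c'"
    "\<And>t e. 0 < t \<Longrightarrow> 0 \<le> e \<Longrightarrow>
      Lq_norm q {0<..<t} (\<lambda>u. ennreal (u powr (- \<theta> - recip q) * b u) * ennreal (u / t * e))
      \<le> ennreal (c * (t powr (- \<theta>) * b t * e))"
    "\<And>t e. 0 < t \<Longrightarrow> 0 \<le> e \<Longrightarrow> ennreal (t powr (- \<theta>) * b t * e)
      \<le> ennreal c' * Lq_norm q {0<..<t} (\<lambda>u. ennreal (u powr (- \<theta> - recip q) * b u) * ennreal (u / t * e))"
proof -
  define s where "s = 1 - \<theta>"
  have s: "0 < s" "0 < s / 2" "0 < 2 * s" using \<theta> by (simp_all add: s_def)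
  obtain c1 where c1: "0 < c1"
      "\<And>u t. 0 < u \<Longrightarrow> u \<le> t \<Longrightarrow> u powr (s / 2) * b u \<le> c1 * (t powr (s / 2) * b t)"
    using slowly_varying_almost_increasing[OF b s(2)] by metis
  obtain c2 where c2: "0 < c2"
      "\<And>u t. 0 < u \<Longrightarrow> u \<le> t \<Longrightarrow> t powr (- s) * b t \<le> c2 * (u powr (- s) * b u)"
    using slowly_varying_almost_decreasing[OF b s(1)] by metis
  obtain \<kappa>1 where \<kappa>1: "0 < \<kappa>1" "\<And>t. 0 < t \<Longrightarrow>
      Lq_norm q {0<..<t} (\<lambda>u. ennreal (u powr (s / 2 - recip q))) \<le> ennreal (\<kappa>1 * t powr (s / 2))"
    using Lq_norm_power_below[OF q s(2)] by metis
  obtain \<kappa>2 where \<kappa>2: "0 < \<kappa>2" "\<And>t. 0 < t \<Longrightarrow>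
      ennreal (\<kappa>2 * t powr (2 * s)) \<le> Lq_norm q {0<..<t} (\<lambda>u. ennreal (u powr (2 * s - recip q)))"
    using Lq_norm_power_below[OF q s(3)] by metis
  have meas: "(\<lambda>u. ennreal (u powr (- \<theta> - recip q) * b u) * ennreal (u / t * e))
      \<in> borel_measurable (lebesgue_on {0<..<t})" for t e
  proof -
    have [measurable]: "(\<lambda>u. ennreal (u powr (- \<theta> - recip q) * b u)) \<in> borel_measurable (lebesgue_on {0<..<t})"
      by (rule measurable_weight[OF b]) auto
    show ?thesis by measurable
  qed
  show ?thesis
  proof (rule that[of "c1 * \<kappa>1" "c2 / \<kappa>2"])
    fix t e :: real assume t: "0 < t" and e: "0 \<le> e"
    let ?F = "\<lambda>u. ennreal (u powr (- \<theta> - recip q) * b u) * ennreal (u / t * e)"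
    \<comment> \<open>The power \<open>u powr a\<close> is split off to be combined with \<open>b u\<close>; below, \<open>a\<close> is \<open>s/2\<close> or \<open>- s\<close>.\<close>
    have F: "?F u = ennreal (u powr (s - a - recip q) * (u powr a * b u) * (e / t))" if "0 < u" for u a
    proof -
      have "u powr (- \<theta> - recip q) * u = u powr (s - a - recip q) * u powr a"
        using that by (simp add: s_def powr_diff powr_minus field_simps flip: powr_add)
      with that t e slowly_varying_pos[OF b that] show ?thesis
        by (simp add: mult_ac flip: ennreal_mult)
    qed
    have tpow: "t powr a * b t * (e / t) * (k * t powr (s - a)) = k * (t powr (- \<theta>) * b t * e)" for a k
      using t by (simp add: s_def powr_diff powr_minus powr_add field_simps)
    have "Lq_norm q {0<..<t} ?F
        \<le> Lq_norm q {0<..<t} (\<lambda>u. ennreal (c1 * (t powr (s / 2) * b t) * (e / t)) * ennreal (u powr (s / 2 - recip q)))"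
    proof (rule Lq_norm_mono[OF q meas])
      fix u assume u: "u \<in> {0<..<t}"
      then have "u powr (s - s / 2 - recip q) * (u powr (s / 2) * b u) * (e / t)
          \<le> u powr (s - s / 2 - recip q) * (c1 * (t powr (s / 2) * b t)) * (e / t)"
        using c1(2)[of u t] t e by (intro mult_right_mono mult_left_mono) auto
      with u F[of u "s / 2"] c1(1) t e slowly_varying_pos[OF b t] show "?F u \<le> ennreal (c1 * (t powr (s / 2) * b t) * (e / t)) * ennreal (u powr (s / 2 - recip q))"
        by (simp add: mult_ac ennreal_leI flip: ennreal_mult)
    qed
    also have "\<dots> \<le> ennreal (c1 * (t powr (s / 2) * b t) * (e / t)) * ennreal (\<kappa>1 * t powr (s / 2))"
      using \<kappa>1(2)[OF t] by (subst Lq_norm_cmult[OF q measurable_power]) (auto intro: mult_left_mono)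
    also have "\<dots> = ennreal (c1 * \<kappa>1 * (t powr (- \<theta>) * b t * e))"
    proof -
      have "c1 * (t powr (s / 2) * b t) * (e / t) * (\<kappa>1 * t powr (s / 2)) = c1 * \<kappa>1 * (t powr (- \<theta>) * b t * e)"
        using arg_cong[OF tpow[of "s / 2" \<kappa>1], of "\<lambda>x. c1 * x"] by (simp add: mult.assoc)
      with \<kappa>1(1) show ?thesis by (simp only: ennreal_mult''[symmetric] mult_nonneg_nonneg powr_ge_zero less_imp_le)
    qed
    finally show "Lq_norm q {0<..<t} ?F \<le> ennreal (c1 * \<kappa>1 * (t powr (- \<theta>) * b t * e))" .
    have "ennreal (t powr (- \<theta>) * b t * e)
        = ennreal (c2 / \<kappa>2) * (ennreal (1 / c2 * (t powr (- s) * b t) * (e / t)) * ennreal (\<kappa>2 * t powr (2 * s)))"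
      using tpow[of "- s" \<kappa>2] \<kappa>2(1) c2(1) t e slowly_varying_pos[OF b t]
      by (simp flip: ennreal_mult) (auto simp: field_simps)
    also have "\<dots> \<le> ennreal (c2 / \<kappa>2) *
        Lq_norm q {0<..<t} (\<lambda>u. ennreal (1 / c2 * (t powr (- s) * b t) * (e / t)) * ennreal (u powr (2 * s - recip q)))"
      using \<kappa>2(2)[OF t]
      by (subst Lq_norm_cmult[OF q measurable_power]) (intro mult_left_mono, simp_all)
    also have "\<dots> \<le> ennreal (c2 / \<kappa>2) * Lq_norm q {0<..<t} ?F"
    proof (intro mult_left_mono Lq_norm_mono[OF q])
      show "(\<lambda>u. ennreal (1 / c2 * (t powr (- s) * b t) * (e / t)) * ennreal (u powr (2 * s - recip q)))
          \<in> borel_measurable (lebesgue_on {0<..<t})"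
        by measurable
      fix u assume u: "u \<in> {0<..<t}"
      then have "1 / c2 * (t powr (- s) * b t) \<le> u powr (- s) * b u"
        using c2(2)[of u t] c2(1) by (simp add: field_simps)
      then have "u powr (s - - s - recip q) * (1 / c2 * (t powr (- s) * b t)) * (e / t)
          \<le> u powr (s - - s - recip q) * (u powr (- s) * b u) * (e / t)"
        using t e by (intro mult_right_mono mult_left_mono) auto
      with u F[of u "- s"] c2(1) t e slowly_varying_pos[OF b t] show "ennreal (1 / c2 * (t powr (- s) * b t) * (e / t)) * ennreal (u powr (2 * s - recip q)) \<le> ?F u"
        by (simp add: mult_ac ennreal_leI flip: ennreal_mult)
    qed simp
    finally show "ennreal (t powr (- \<theta>) * b t * e) \<le> ennreal (c2 / \<kappa>2) * Lq_norm q {0<..<t} ?F" .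
  qed (use c1 c2 \<kappa>1 \<kappa>2 in auto)
qed

text \<open>
  Above \<open>t\<close> the \<open>K\<close>-functional is controlled by a constant \<open>e\<close>, and it is \<open>\<theta> > 0\<close> that provides
  the decay: \<open>u powr (- \<theta>/2)\<close> absorbs \<open>b\<close> and another \<open>u powr (- \<theta>/2)\<close> is left for the norm.
\<close>

lemma slowly_varying_weight_above:
  assumes b: "slowly_varying b" and q: "0 < q" and \<theta>: "0 < \<theta>"
  obtains c where "0 < c"
    "\<And>t e. 0 < t \<Longrightarrow> 0 \<le> e \<Longrightarrow>
      Lq_norm q {t<..} (\<lambda>u. ennreal (u powr (- \<theta> - recip q) * b u) * ennreal e)
      \<le> ennreal (c * (t powr (- \<theta>) * b t * e))"
proof -
  have \<theta>2: "0 < \<theta> / 2" using \<theta> by simp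
  obtain c1 where c1: "0 < c1"
      "\<And>u t. 0 < u \<Longrightarrow> u \<le> t \<Longrightarrow> t powr (- (\<theta> / 2)) * b t \<le> c1 * (u powr (- (\<theta> / 2)) * b u)"
    using slowly_varying_almost_decreasing[OF b \<theta>2] by metis
  obtain \<kappa> where \<kappa>: "0 < \<kappa>" "\<And>t. 0 < t \<Longrightarrow>
      Lq_norm q {t<..} (\<lambda>u. ennreal (u powr (- (\<theta> / 2) - recip q))) \<le> ennreal (\<kappa> * t powr (- (\<theta> / 2)))"
    using Lq_norm_power_above[OF q \<theta>2] by metis
  show ?thesis
  proof (rule that[of "c1 * \<kappa>"])
    fix t e :: real assume t: "0 < t" and e: "0 \<le> e"
    let ?F = "\<lambda>u. ennreal (u powr (- \<theta> - recip q) * b u) * ennreal e"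
    have [measurable]: "(\<lambda>u. ennreal (u powr (- \<theta> - recip q) * b u)) \<in> borel_measurable (lebesgue_on {t<..})"
      using t by (intro measurable_weight[OF b]) auto
    have "Lq_norm q {t<..} ?F
        \<le> Lq_norm q {t<..} (\<lambda>u. ennreal (c1 * (t powr (- (\<theta> / 2)) * b t) * e) * ennreal (u powr (- (\<theta> / 2) - recip q)))"
    proof (rule Lq_norm_mono[OF q])
      fix u assume u: "u \<in> {t<..}"
      then have "u powr (- (\<theta> / 2) - recip q) * (u powr (- (\<theta> / 2)) * b u) * e
          \<le> u powr (- (\<theta> / 2) - recip q) * (c1 * (t powr (- (\<theta> / 2)) * b t)) * e"
        using c1(2)[of t u] t e by (intro mult_right_mono mult_left_mono) auto
      moreover have "u powr (- \<theta> - recip q) = u powr (- (\<theta> / 2) - recip q) * u powr (- (\<theta> / 2))"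
        by (simp flip: powr_add)
      ultimately show "?F u \<le> ennreal (c1 * (t powr (- (\<theta> / 2)) * b t) * e) * ennreal (u powr (- (\<theta> / 2) - recip q))"
        using e c1(1) slowly_varying_pos[OF b t] slowly_varying_pos[OF b, of u] u t
        by (simp add: mult_ac ennreal_leI flip: ennreal_mult)
    qed measurable
    also have "\<dots> \<le> ennreal (c1 * (t powr (- (\<theta> / 2)) * b t) * e) * ennreal (\<kappa> * t powr (- (\<theta> / 2)))"
      using \<kappa>(2)[OF t] by (subst Lq_norm_cmult[OF q measurable_power]) (auto intro: mult_left_mono)
    also have "\<dots> = ennreal (c1 * \<kappa> * (t powr (- \<theta>) * b t * e))"
    proof -
      have "t powr (- \<theta>) = t powr (- (\<theta> / 2)) * t powr (- (\<theta> / 2))"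
        by (simp flip: powr_add)
      with \<kappa>(1) c1(1) e slowly_varying_pos[OF b t] show ?thesis
        by (simp add: mult_ac flip: ennreal_mult)
    qed
    finally show "Lq_norm q {t<..} ?F \<le> ennreal (c1 * \<kappa> * (t powr (- \<theta>) * b t * e))" .
  qed (use c1 \<kappa> in auto)
qed

section \<open>The K-functional\<close>

lemma quasi_normed_space_zero:
  "quasi_normed_space A \<Longrightarrow> 0 \<in> vecs A" "quasi_normed_space A \<Longrightarrow> qnorm A 0 = 0"
  by (auto simp: quasi_normed_space_def subspace_0)

lemma quasi_normed_space_nonneg:
  "quasi_normed_space A \<Longrightarrow> x \<in> vecs A \<Longrightarrow> 0 \<le> qnorm A x"
  by (simp add: quasi_normed_space_def)

lemma quasi_normed_space_uminus:
  assumes "quasi_normed_space A" "x \<in> vecs A"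
  shows "- x \<in> vecs A" "qnorm A (- x) = qnorm A x"
proof -
  from assms(1) have A: "subspace (vecs A)"
      "\<And>c x. x \<in> vecs A \<Longrightarrow> qnorm A (c *\<^sub>R x) = \<bar>c\<bar> * qnorm A x"
    by (simp_all add: quasi_normed_space_def)
  show "- x \<in> vecs A" using A(1) assms(2) by (rule subspace_neg)
  show "qnorm A (- x) = qnorm A x" using A(2)[OF assms(2), of "- 1"] by simp
qed

lemma K_functional_le:
  assumes "f0 \<in> vecs A0" "f1 \<in> vecs A1"
  shows "K_functional t (f0 + f1) A0 A1 \<le> ennreal (qnorm A0 f0 + t * qnorm A1 f1)"
  unfolding K_functional_def using assms by (intro Inf_lower) blast

lemma K_functional_greatest:
  assumes "\<And>f0 f1. f0 \<in> vecs A0 \<Longrightarrow> f1 \<in> vecs A1 \<Longrightarrow> f = f0 + f1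
    \<Longrightarrow> z \<le> ennreal (qnorm A0 f0 + t * qnorm A1 f1)"
  shows "z \<le> K_functional t f A0 A1"
  unfolding K_functional_def using assms by (intro Inf_greatest) blast

text \<open>
  The infimum in \<open>K\<close> is in general not attained. An estimate that is affine in the cost of an
  arbitrary decomposition passes to the infimum directly, so no approximate minimiser has to be
  chosen.
\<close>

lemma K_functional_greatest_affine:
  assumes w: "0 < w" and le: "\<And>f0 f1. f0 \<in> vecs A0 \<Longrightarrow> f1 \<in> vecs A1 \<Longrightarrow> f = f0 + f1
    \<Longrightarrow> z \<le> y + ennreal w * ennreal (qnorm A0 f0 + t * qnorm A1 f1)"
  shows "z \<le> y + ennreal w * K_functional t f A0 A1"
proof (cases "y = top")
  case False
  have inv: "ennreal (1 / w) * (ennreal w * x) = x" "ennreal w * (ennreal (1 / w) * x) = x" for x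
    using w by (simp_all flip: mult.assoc ennreal_mult)
  have "ennreal (1 / w) * (z - y) \<le> K_functional t f A0 A1"
  proof (rule K_functional_greatest)
    fix f0 f1 assume "f0 \<in> vecs A0" "f1 \<in> vecs A1" "f = f0 + f1"
    from le[OF this] False have "z - y \<le> ennreal w * ennreal (qnorm A0 f0 + t * qnorm A1 f1)"
      by (simp add: ennreal_minus_le_iff)
    from mult_left_mono[OF this, of "ennreal (1 / w)"]
    show "ennreal (1 / w) * (z - y) \<le> ennreal (qnorm A0 f0 + t * qnorm A1 f1)"
      by (simp add: inv)
  qed
  from mult_left_mono[OF this, of "ennreal w"]
  have "z - y \<le> ennreal w * K_functional t f A0 A1"
    by (simp add: inv)
  with False show ?thesis by (simp add: ennreal_minus_le_iff)
qed simp

lemma K_functional_finite: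
  assumes "f \<in> sum_space A0 A1"
  shows "K_functional t f A0 A1 \<noteq> top"
proof -
  from assms obtain f0 f1 where "f0 \<in> vecs A0" "f1 \<in> vecs A1" "f = f0 + f1"
    by (auto simp: sum_space_def)
  with K_functional_le[of f0 A0 f1 A1 t] show ?thesis by (auto simp: top_unique)
qed

lemma K_functional_le_left:
  assumes "quasi_normed_space A1" "f \<in> vecs A0"
  shows "K_functional t f A0 A1 \<le> ennreal (qnorm A0 f)"
  using K_functional_le[of f A0 0 A1 t] assms by (simp add: quasi_normed_space_zero)

lemma K_functional_le_right:
  assumes "quasi_normed_space A0" "f \<in> vecs A1"
  shows "K_functional t f A0 A1 \<le> ennreal (t * qnorm A1 f)"
  using K_functional_le[of 0 A0 f A1 t] assms by (simp add: quasi_normed_space_zero)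

lemma K_functional_mono:
  assumes "quasi_normed_space A1" "u \<le> t"
  shows "K_functional u f A0 A1 \<le> K_functional t f A0 A1"
proof (rule K_functional_greatest)
  fix f0 f1 assume f: "f0 \<in> vecs A0" "f1 \<in> vecs A1" "f = f0 + f1"
  have "K_functional u f A0 A1 \<le> ennreal (qnorm A0 f0 + u * qnorm A1 f1)"
    using f by (simp add: K_functional_le)
  also have "\<dots> \<le> ennreal (qnorm A0 f0 + t * qnorm A1 f1)"
    using assms f by (intro ennreal_leI add_left_mono mult_right_mono) (auto intro: quasi_normed_space_nonneg)
  finally show "K_functional u f A0 A1 \<le> ennreal (qnorm A0 f0 + t * qnorm A1 f1)" .
qed

text \<open>
  The factor \<open>u / t \<le> 1\<close> reduces the first summand and turns \<open>t\<close> into \<open>u\<close> in the second one.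
\<close>

lemma K_functional_quasiconcave:
  assumes "quasi_normed_space A0" "0 < u" "u \<le> t"
  shows "ennreal (u / t) * K_functional t f A0 A1 \<le> K_functional u f A0 A1"
proof (rule K_functional_greatest)
  fix f0 f1 assume f: "f0 \<in> vecs A0" "f1 \<in> vecs A1" "f = f0 + f1"
  have "ennreal (u / t) * K_functional t f A0 A1 \<le> ennreal (u / t) * ennreal (qnorm A0 f0 + t * qnorm A1 f1)"
    using f by (intro mult_left_mono) (simp_all add: K_functional_le)
  also have "\<dots> = ennreal (u / t * qnorm A0 f0 + u * qnorm A1 f1)"
    using assms by (simp add: field_simps flip: ennreal_mult')
  also have "\<dots> \<le> ennreal (qnorm A0 f0 + u * qnorm A1 f1)"
    using assms f by (intro ennreal_leI add_right_mono mult_left_le_one_le) (auto intro: quasi_normed_space_nonneg)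
  finally show "ennreal (u / t) * K_functional t f A0 A1 \<le> ennreal (qnorm A0 f0 + u * qnorm A1 f1)" .
qed

lemma K_functional_add:
  assumes A0: "quasi_normed_space A0" and A1: "quasi_normed_space A1"
  obtains C where "0 < C" "\<And>u f g. 0 < u \<Longrightarrow>
    K_functional u (f + g) A0 A1 \<le> ennreal C * (K_functional u f A0 A1 + K_functional u g A0 A1)"
proof -
  have "\<exists>C\<ge>1. \<forall>x\<in>vecs A0. \<forall>y\<in>vecs A0. qnorm A0 (x + y) \<le> C * (qnorm A0 x + qnorm A0 y)"
    using A0 by (simp add: quasi_normed_space_def)
  then obtain C0 where C0: "1 \<le> C0" "\<And>x y. x \<in> vecs A0 \<Longrightarrow> y \<in> vecs A0 \<Longrightarrow>
      qnorm A0 (x + y) \<le> C0 * (qnorm A0 x + qnorm A0 y)"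
    by blast
  have "\<exists>C\<ge>1. \<forall>x\<in>vecs A1. \<forall>y\<in>vecs A1. qnorm A1 (x + y) \<le> C * (qnorm A1 x + qnorm A1 y)"
    using A1 by (simp add: quasi_normed_space_def)
  then obtain C1 where C1: "1 \<le> C1" "\<And>x y. x \<in> vecs A1 \<Longrightarrow> y \<in> vecs A1 \<Longrightarrow>
      qnorm A1 (x + y) \<le> C1 * (qnorm A1 x + qnorm A1 y)"
    by blast
  have sub: "subspace (vecs A0)" "subspace (vecs A1)"
    using A0 A1 by (simp_all add: quasi_normed_space_def)
  define C where "C = max C0 C1"
  have C: "0 < C" "C0 \<le> C" "C1 \<le> C" using C0(1) C1(1) by (simp_all add: C_def)
  show ?thesis
  proof (rule that[OF C(1)])
    fix u :: real and f g :: 'a assume u: "0 < u"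
    let ?K = "\<lambda>f. K_functional u f A0 A1"
    have "?K (f + g) \<le> ennreal C * ?K g + ennreal C * ?K f"
    proof (rule K_functional_greatest_affine[OF C(1)])
      fix f0 f1 assume f: "f0 \<in> vecs A0" "f1 \<in> vecs A1" "f = f0 + f1"
      let ?a = "qnorm A0 f0 + u * qnorm A1 f1"
      have "?K (f + g) \<le> ennreal C * ennreal ?a + ennreal C * ?K g"
      proof (rule K_functional_greatest_affine[OF C(1)])
        fix g0 g1 assume g: "g0 \<in> vecs A0" "g1 \<in> vecs A1" "g = g0 + g1"
        note nonneg = quasi_normed_space_nonneg[OF A0 f(1)] quasi_normed_space_nonneg[OF A1 f(2)]
          quasi_normed_space_nonneg[OF A0 g(1)] quasi_normed_space_nonneg[OF A1 g(2)]
        have "?K (f + g) = ?K ((f0 + g0) + (f1 + g1))"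
          using f g by (simp add: algebra_simps)
        also have "\<dots> \<le> ennreal (qnorm A0 (f0 + g0) + u * qnorm A1 (f1 + g1))"
          using f g sub by (intro K_functional_le subspace_add)
        also have "\<dots> \<le> ennreal (C * (qnorm A0 f0 + qnorm A0 g0) + u * (C * (qnorm A1 f1 + qnorm A1 g1)))"
        proof (intro ennreal_leI add_mono mult_left_mono)
          show "qnorm A0 (f0 + g0) \<le> C * (qnorm A0 f0 + qnorm A0 g0)"
            using C0(2)[OF f(1) g(1)] mult_right_mono[OF C(2), of "qnorm A0 f0 + qnorm A0 g0"] nonneg
            by simp
          show "qnorm A1 (f1 + g1) \<le> C * (qnorm A1 f1 + qnorm A1 g1)"
            using C1(2)[OF f(2) g(2)] mult_right_mono[OF C(3), of "qnorm A1 f1 + qnorm A1 g1"] nonneg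
            by simp
        qed (use u in simp)
        also have "\<dots> = ennreal C * ennreal ?a + ennreal C * ennreal (qnorm A0 g0 + u * qnorm A1 g1)"
          using C u nonneg by (simp flip: ennreal_mult ennreal_plus) (simp add: algebra_simps)
        finally show "?K (f + g) \<le> ennreal C * ennreal ?a + ennreal C * ennreal (qnorm A0 g0 + u * qnorm A1 g1)" .
      qed
      then show "?K (f + g) \<le> ennreal C * ?K g + ennreal C * ennreal ?a" by (simp add: add.commute)
    qed
    then show "?K (f + g) \<le> ennreal C * (?K f + ?K g)" by (simp add: distrib_left add.commute)
  qed
qed

text \<open>
  The \<open>K\<close>-functional of an element of the sum space is finite and monotone in \<open>u\<close>, hence Borel.
\<close>

lemma measurable_weighted_K:
  assumes b: "slowly_varying b" and A1: "quasi_normed_space A1"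
    and f: "f \<in> sum_space A0 A1" and S: "S \<subseteq> {0<..}"
  shows "weighted_K \<theta> q b A0 A1 f \<in> borel_measurable (lebesgue_on S)"
proof -
  let ?k = "\<lambda>u. enn2real (K_functional u f A0 A1)"
  have "mono_on UNIV ?k"
    using K_functional_mono[OF A1] K_functional_finite[OF f]
    by (intro mono_onI enn2real_mono) (auto simp: less_top)
  then have "?k \<in> borel_measurable borel"
    using borel_measurable_mono by blast
  then have "?k \<in> borel_measurable (lebesgue_on S)"
    by (intro measurable_restrict_space1 measurable_completion) simp
  then have [measurable]: "(\<lambda>u. ennreal (?k u)) \<in> borel_measurable (lebesgue_on S)" by measurable
  have K: "K_functional u f A0 A1 = ennreal (?k u)" for u
    using K_functional_finite[OF f] by (simp add: less_top)
  note [measurable] = measurable_weight[OF b S]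
  show ?thesis unfolding weighted_K_def[abs_def] by (subst K) measurable
qed

section \<open>K-functionals of interpolation spaces\<close>

text \<open>
  If one of the two norms is infinite, so is the right-hand side; otherwise \<open>f0\<close> and \<open>f1\<close> lie in the
  interpolation spaces and are a competitor in the infimum.
\<close>

lemma K_functional_interp_space_le:
  assumes f: "f0 \<in> sum_space A0 A1" "f1 \<in> sum_space A0 A1" and r: "0 < r"
  shows "K_functional r (f0 + f1) (interp_space \<theta> q b0 A0 A1) (interp_space \<theta> q b1 A0 A1)
    \<le> Lq_norm q {0<..} (weighted_K \<theta> q b0 A0 A1 f0)
       + ennreal r * Lq_norm q {0<..} (weighted_K \<theta> q b1 A0 A1 f1)" (is "?K \<le> ?N0 + ennreal r * ?N1")
proof (cases "?N0 = top \<or> ?N1 = top")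
  case True
  with r show ?thesis by (auto simp: ennreal_mult_top)
next
  case False
  then have "?K \<le> ennreal (enn2real ?N0 + r * enn2real ?N1)"
    using f K_functional_le[of f0 "interp_space \<theta> q b0 A0 A1" f1 "interp_space \<theta> q b1 A0 A1" r]
    by (simp add: interp_space_def less_top)
  also have "\<dots> = ?N0 + ennreal r * ?N1"
    using False r by (simp add: ennreal_mult less_top)
  finally show ?thesis .
qed

lemma K_functional_interp_space_greatest:
  assumes r: "0 < r"
    and le: "\<And>f0 f1. f0 \<in> sum_space A0 A1 \<Longrightarrow> f1 \<in> sum_space A0 A1 \<Longrightarrow> f = f0 + f1 \<Longrightarrow>
      z \<le> ennreal c * (Lq_norm q {0<..} (weighted_K \<theta> q b0 A0 A1 f0)
        + ennreal r * Lq_norm q {0<..} (weighted_K \<theta> q b1 A0 A1 f1))"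
    and c: "0 < c"
  shows "z \<le> ennreal c * K_functional r f (interp_space \<theta> q b0 A0 A1) (interp_space \<theta> q b1 A0 A1)"
proof -
  have "z \<le> 0 + ennreal c * K_functional r f (interp_space \<theta> q b0 A0 A1) (interp_space \<theta> q b1 A0 A1)"
  proof (rule K_functional_greatest_affine[OF c])
    fix f0 f1 assume f: "f0 \<in> vecs (interp_space \<theta> q b0 A0 A1)"
      "f1 \<in> vecs (interp_space \<theta> q b1 A0 A1)" "f = f0 + f1"
    then have "ennreal (qnorm (interp_space \<theta> q b0 A0 A1) f0 + r * qnorm (interp_space \<theta> q b1 A0 A1) f1)
        = Lq_norm q {0<..} (weighted_K \<theta> q b0 A0 A1 f0)
          + ennreal r * Lq_norm q {0<..} (weighted_K \<theta> q b1 A0 A1 f1)"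
      using r by (simp add: interp_space_def ennreal_mult)
    moreover have "f0 \<in> sum_space A0 A1" "f1 \<in> sum_space A0 A1"
      using f by (simp_all add: interp_space_def)
    ultimately show "z \<le> 0 + ennreal c *
        ennreal (qnorm (interp_space \<theta> q b0 A0 A1) f0 + r * qnorm (interp_space \<theta> q b1 A0 A1) f1)"
      using le f(3) by simp
  qed
  then show ?thesis by simp
qed

lemma Lq_norm_add_mult:
  assumes q: "0 < q" and meas: "g \<in> borel_measurable (lebesgue_on S)" "h \<in> borel_measurable (lebesgue_on S)"
      "k \<in> borel_measurable (lebesgue_on S)"
    and le: "\<And>u. u \<in> S \<Longrightarrow> k u \<le> ennreal C * (g u + h u)" and C: "0 < C"
  shows "Lq_norm q S k \<le> ennreal (C * 2 powr (1 + recip q)) * (Lq_norm q S g + Lq_norm q S h)"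
proof -
  note [measurable] = meas
  have "Lq_norm q S k \<le> Lq_norm q S (\<lambda>u. ennreal C * (g u + h u))"
    by (rule Lq_norm_mono[OF q meas(3) le])
  also have "\<dots> = ennreal C * Lq_norm q S (\<lambda>u. g u + h u)"
    by (rule Lq_norm_cmult[OF q]) measurable
  also have "\<dots> \<le> ennreal C * (ennreal (2 powr (1 + recip q)) * (Lq_norm q S g + Lq_norm q S h))"
    by (intro mult_left_mono Lq_norm_add[OF q meas(1,2)]) simp
  finally show ?thesis using C by (simp add: ennreal_mult mult.assoc)
qed

section \<open>The two halves of the equivalence\<close>

text \<open>
  Given \<open>f = f0 + f1\<close>, the quasi-triangle inequality for \<open>K\<close> bounds either term by the contributions
  of \<open>f0\<close> and \<open>f1\<close>, and monotonicity of \<open>\<rho>\<close> moves the weights to the right places: \<open>b0 = \<rho> * b1\<close> is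
  at most \<open>\<rho> t * b1\<close> below \<open>t\<close>, while \<open>\<rho> t * b1\<close> is at most \<open>b0\<close> above \<open>t\<close>.
\<close>

lemma weighted_norms_le_K_functional_interp_space:
  fixes A0 A1 :: "'a::real_vector qspace"
  assumes A0: "quasi_normed_space A0" and A1: "quasi_normed_space A1" and q: "0 < q"
    and b0: "slowly_varying b0" and b1: "slowly_varying b1"
    and \<rho>: "\<rho> = (\<lambda>t. b0 t / b1 t)" "mono_on {0<..} \<rho>"
  obtains c where "0 < c" "\<And>f t. f \<in> sum_space A0 A1 \<Longrightarrow> 0 < t \<Longrightarrow>
    Lq_norm q {0<..<t} (weighted_K \<theta> q b0 A0 A1 f)
      + ennreal (\<rho> t) * Lq_norm q {t<..} (weighted_K \<theta> q b1 A0 A1 f)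
    \<le> ennreal c * K_functional (\<rho> t) f (interp_space \<theta> q b0 A0 A1) (interp_space \<theta> q b1 A0 A1)"
proof -
  obtain C where C: "0 < C" "\<And>u f g. 0 < u \<Longrightarrow>
      K_functional u (f + g) A0 A1 \<le> ennreal C * (K_functional u f A0 A1 + K_functional u g A0 A1)"
    using K_functional_add[OF A0 A1] by metis
  define D where "D = C * 2 powr (1 + recip q)"
  have D: "0 < D" using C by (simp add: D_def)
  show ?thesis
  proof (rule that[of "2 * D"])
    fix f :: 'a and t :: real assume f: "f \<in> sum_space A0 A1" and t: "0 < t"
    have \<rho>_pos: "0 < \<rho> t" using \<rho>(1) slowly_varying_pos[OF b0 t] slowly_varying_pos[OF b1 t] by simp
    note meas = measurable_weighted_K[OF b0 A1] measurable_weighted_K[OF b1 A1]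
    show "Lq_norm q {0<..<t} (weighted_K \<theta> q b0 A0 A1 f)
        + ennreal (\<rho> t) * Lq_norm q {t<..} (weighted_K \<theta> q b1 A0 A1 f)
      \<le> ennreal (2 * D) * K_functional (\<rho> t) f (interp_space \<theta> q b0 A0 A1) (interp_space \<theta> q b1 A0 A1)"
    proof (rule K_functional_interp_space_greatest[OF \<rho>_pos])
      fix f0 f1 assume f01: "f0 \<in> sum_space A0 A1" "f1 \<in> sum_space A0 A1" "f = f0 + f1"
      let ?W0 = "weighted_K \<theta> q b0 A0 A1" and ?W1 = "weighted_K \<theta> q b1 A0 A1"
      let ?N = "Lq_norm q {0<..} (?W0 f0) + ennreal (\<rho> t) * Lq_norm q {0<..} (?W1 f1)"
      \<comment> \<open>Both terms use a weight \<open>w\<close> below \<open>b0\<close> and below \<open>\<rho> t * b1\<close>: it is \<open>b0\<close> on \<open>(0, t)\<close> and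
        \<open>\<rho> t * b1\<close> on \<open>(t, \<infinity>)\<close>.\<close>
      have bound: "Lq_norm q S (\<lambda>u. ennreal (u powr (- \<theta> - recip q) * w u) * K_functional u f A0 A1) \<le> ennreal D * ?N"
        if S: "S \<in> sets lebesgue" "S \<subseteq> {0<..}"
          and m: "(\<lambda>u. ennreal (u powr (- \<theta> - recip q) * w u) * K_functional u f A0 A1) \<in> borel_measurable (lebesgue_on S)"
          and w: "\<And>u. u \<in> S \<Longrightarrow> 0 \<le> w u \<and> w u \<le> b0 u \<and> w u \<le> \<rho> t * b1 u"
        for S w
      proof -
        have m1: "(\<lambda>u. ennreal (\<rho> t) * ?W1 f1 u) \<in> borel_measurable (lebesgue_on S)"
          using meas(2)[OF f01(2) S(2)] by measurable
        have "Lq_norm q S (\<lambda>u. ennreal (u powr (- \<theta> - recip q) * w u) * K_functional u f A0 A1)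
            \<le> ennreal D * (Lq_norm q S (?W0 f0) + Lq_norm q S (\<lambda>u. ennreal (\<rho> t) * ?W1 f1 u))"
          unfolding D_def
        proof (rule Lq_norm_add_mult[OF q meas(1)[OF f01(1) S(2)] m1 m _ C(1)])
          fix u assume u: "u \<in> S"
          with S have u0: "0 < u" by auto
          let ?p = "u powr (- \<theta> - recip q)"
          have "ennreal (?p * w u) * K_functional u f A0 A1
              \<le> ennreal (?p * w u) * (ennreal C * (K_functional u f0 A0 A1 + K_functional u f1 A0 A1))"
            unfolding f01(3) using C(2)[OF u0] by (rule mult_left_mono) simp
          also have "\<dots> = ennreal C * (ennreal (?p * w u) * K_functional u f0 A0 A1
              + ennreal (?p * w u) * K_functional u f1 A0 A1)"
            by (simp add: algebra_simps)
          also have "\<dots> \<le> ennreal C * (ennreal (?p * b0 u) * K_functional u f0 A0 A1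
              + ennreal (?p * (\<rho> t * b1 u)) * K_functional u f1 A0 A1)"
            using w[OF u] by (intro mult_left_mono add_mono mult_right_mono ennreal_leI) auto
          also have "ennreal (?p * (\<rho> t * b1 u)) = ennreal (\<rho> t) * ennreal (?p * b1 u)"
            using \<rho>_pos by (simp add: mult.left_commute flip: ennreal_mult')
          finally show "ennreal (?p * w u) * K_functional u f A0 A1
              \<le> ennreal C * (?W0 f0 u + ennreal (\<rho> t) * ?W1 f1 u)"
            by (simp add: weighted_K_def mult.assoc)
        qed
        also have "Lq_norm q S (\<lambda>u. ennreal (\<rho> t) * ?W1 f1 u) = ennreal (\<rho> t) * Lq_norm q S (?W1 f1)"
          by (rule Lq_norm_cmult[OF q meas(2)[OF f01(2) S(2)]])
        also have "ennreal D * (Lq_norm q S (?W0 f0) + \<dots>) \<le> ennreal D * ?N"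
          using S by (intro mult_left_mono add_mono Lq_norm_subset[OF q] meas f01) auto
        finally show ?thesis .
      qed
      have sub: "{0<..<t} \<subseteq> {0<..}" by auto
      have mono: "\<rho> u \<le> \<rho> v" if "0 < u" "u \<le> v" for u v
        using \<rho>(2) that by (auto simp: mono_on_def)
      have \<rho>_mult: "\<rho> u * b1 u = b0 u" if "0 < u" for u
        using \<rho>(1) slowly_varying_pos[OF b1 that] by simp
      have "Lq_norm q {0<..<t} (?W0 f) \<le> ennreal D * ?N"
        unfolding weighted_K_def[of \<theta> q b0 A0 A1 f, abs_def]
      proof (rule bound)
        show "(\<lambda>u. ennreal (u powr (- \<theta> - recip q) * b0 u) * K_functional u f A0 A1) \<in> borel_measurable (lebesgue_on {0<..<t})"
          using meas(1)[OF f, of "{0<..<t}" \<theta> q, OF sub] by (simp add: weighted_K_def[abs_def])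
        fix u assume u: "u \<in> {0<..<t}"
        have "\<rho> u * b1 u \<le> \<rho> t * b1 u"
          using u mono[of u t] slowly_varying_pos[OF b1, of u] by (intro mult_right_mono) auto
        with u show "0 \<le> b0 u \<and> b0 u \<le> b0 u \<and> b0 u \<le> \<rho> t * b1 u"
          using slowly_varying_pos[OF b0, of u] \<rho>_mult[of u] by simp
      qed auto
      moreover have "ennreal (\<rho> t) * Lq_norm q {t<..} (?W1 f) \<le> ennreal D * ?N"
      proof -
        have m: "?W1 f \<in> borel_measurable (lebesgue_on {t<..})"
          using t by (intro meas f) auto
        have eq: "ennreal (\<rho> t) * ?W1 f u = ennreal (u powr (- \<theta> - recip q) * (\<rho> t * b1 u)) * K_functional u f A0 A1" for u
          using \<rho>_pos by (simp add: weighted_K_def mult.left_commute ennreal_mult' mult.assoc)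
        have m': "(\<lambda>u. ennreal (\<rho> t) * ?W1 f u) \<in> borel_measurable (lebesgue_on {t<..})"
          using m by measurable
        have "ennreal (\<rho> t) * Lq_norm q {t<..} (?W1 f) = Lq_norm q {t<..} (\<lambda>u. ennreal (\<rho> t) * ?W1 f u)"
          by (rule Lq_norm_cmult[OF q m, symmetric])
        also have "\<dots> \<le> ennreal D * ?N"
          unfolding eq
        proof (rule bound)
          show "(\<lambda>u. ennreal (u powr (- \<theta> - recip q) * (\<rho> t * b1 u)) * K_functional u f A0 A1)
              \<in> borel_measurable (lebesgue_on {t<..})"
            using m' by (simp only: eq)
          fix u assume u: "u \<in> {t<..}"
          have "\<rho> t * b1 u \<le> \<rho> u * b1 u"
            using u t mono[of t u] slowly_varying_pos[OF b1, of u] by (intro mult_right_mono) auto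
          with u t show "0 \<le> \<rho> t * b1 u \<and> \<rho> t * b1 u \<le> b0 u \<and> \<rho> t * b1 u \<le> \<rho> t * b1 u"
            using slowly_varying_pos[OF b1, of u] \<rho>_mult[of u] \<rho>_pos by simp
        qed (use t in auto)
        finally show ?thesis .
      qed
      ultimately have "Lq_norm q {0<..<t} (?W0 f) + ennreal (\<rho> t) * Lq_norm q {t<..} (?W1 f)
          \<le> ennreal D * ?N + ennreal D * ?N"
        by (rule add_mono)
      also have "\<dots> = ennreal (2 * D) * ?N"
      proof -
        have "ennreal (2 * D) = 2 * ennreal D" using D by (simp add: ennreal_mult)
        then show ?thesis by (simp only: mult_2 distrib_right)
      qed
      finally show "Lq_norm q {0<..<t} (?W0 f) + ennreal (\<rho> t) * Lq_norm q {t<..} (?W1 f)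
          \<le> ennreal (2 * D) * ?N" .
    qed (use D in simp)
  qed (use D in simp)
qed

text \<open>
  Bookkeeping of constants for the next two lemmas.
\<close>

lemma ennreal_split_sum_le:
  assumes M: "0 \<le> M" and P: "0 \<le> P" and c: "0 \<le> c'" "0 \<le> c''" and x: "0 \<le> x"
  shows "ennreal P * (ennreal M * (y + ennreal (c' * x)) + ennreal (c'' * x))
    \<le> ennreal (P * (M + M * c' + c'')) * (y + ennreal x)"
proof -
  have "ennreal P * (ennreal M * (y + ennreal (c' * x)) + ennreal (c'' * x))
      = ennreal (P * M) * y + ennreal (P * (M * c' + c'') * x)"
    using assms by (simp add: distrib_left ennreal_mult ennreal_plus algebra_simps)
  also have "\<dots> \<le> ennreal (P * (M + M * c' + c'')) * y + ennreal (P * (M + M * c' + c'') * x)"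
    using assms by (intro add_mono mult_right_mono ennreal_leI mult_left_mono) auto
  also have "\<dots> = ennreal (P * (M + M * c' + c'')) * (y + ennreal x)"
    using assms by (simp add: distrib_left ennreal_mult)
  finally show ?thesis .
qed

text \<open>
  This lemma is applied to the component \<open>g = f0\<close> of \<open>f = f0 + f1\<close> in \<open>A0 + A1\<close>, with \<open>e\<close> the cost
  of the decomposition at \<open>t\<close>: below \<open>t\<close> one compares \<open>f0\<close> with \<open>f\<close>, and \<open>f1\<close> costs at most
  \<open>u / t * e\<close>; above \<open>t\<close> one uses \<open>f0\<close> itself as an element of \<open>A0\<close>. Both errors have
  weighted norm comparable to \<open>t powr (- \<theta>) * b t * e\<close>.
\<close>

lemma weighted_K_norm_le_below:
  assumes A1: "quasi_normed_space A1" and q: "0 < q" and \<theta>: "0 < \<theta>" "\<theta> < 1"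
    and b: "slowly_varying b" and C: "0 < C"
  obtains c where "0 < c"
    "\<And>f g t e. f \<in> sum_space A0 A1 \<Longrightarrow> g \<in> sum_space A0 A1 \<Longrightarrow> 0 < t \<Longrightarrow> 0 \<le> e
      \<Longrightarrow> \<forall>u\<in>{0<..<t}. K_functional u g A0 A1 \<le> ennreal C * (K_functional u f A0 A1 + ennreal (u / t * e))
      \<Longrightarrow> \<forall>u\<in>{t<..}. K_functional u g A0 A1 \<le> ennreal e
      \<Longrightarrow> Lq_norm q {0<..} (weighted_K \<theta> q b A0 A1 g)
        \<le> ennreal c * (Lq_norm q {0<..<t} (weighted_K \<theta> q b A0 A1 f) + ennreal (t powr (- \<theta>) * b t * e))"
proof -
  let ?W = "\<lambda>u. ennreal (u powr (- \<theta> - recip q) * b u)"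
  obtain c1 where c1: "0 < c1" "\<And>t e. 0 < t \<Longrightarrow> 0 \<le> e \<Longrightarrow>
      Lq_norm q {0<..<t} (\<lambda>u. ?W u * ennreal (u / t * e)) \<le> ennreal (c1 * (t powr (- \<theta>) * b t * e))"
    by (rule slowly_varying_weight_below[OF b q \<theta>(2)]) (rule that)
  obtain c2 where c2: "0 < c2" "\<And>t e. 0 < t \<Longrightarrow> 0 \<le> e \<Longrightarrow>
      Lq_norm q {t<..} (\<lambda>u. ?W u * ennreal e) \<le> ennreal (c2 * (t powr (- \<theta>) * b t * e))"
    by (rule slowly_varying_weight_above[OF b q \<theta>(1)]) (rule that)
  define P where "P = (2::real) powr (1 + recip q)"
  define M where "M = C * P"
  have pos: "0 < P" "0 < M" using C by (auto simp: P_def M_def)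
  note meas = measurable_weighted_K[OF b A1]
  show ?thesis
  proof (rule that[of "P * (M + M * c1 + c2)"])
    show "0 < P * (M + M * c1 + c2)"
      using pos c1(1) c2(1) by (intro mult_pos_pos add_pos_pos) auto
  next
    fix f g and t e :: real
    assume f: "f \<in> sum_space A0 A1" and g: "g \<in> sum_space A0 A1" and t: "0 < t" and e: "0 \<le> e"
      and K: "\<forall>u\<in>{0<..<t}. K_functional u g A0 A1 \<le> ennreal C * (K_functional u f A0 A1 + ennreal (u / t * e))"
        "\<forall>u\<in>{t<..}. K_functional u g A0 A1 \<le> ennreal e"
    let ?x = "t powr (- \<theta>) * b t * e"
    let ?N = "\<lambda>S f. Lq_norm q S (weighted_K \<theta> q b A0 A1 f)"
    have x: "0 \<le> ?x" using e slowly_varying_pos[OF b t] by simp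
    have sub: "{0<..<t} \<subseteq> {0<..}" "{t<..} \<subseteq> {0<..}" using t by auto
    note [measurable] = measurable_weight[OF b sub(1), of "- \<theta> - recip q"]
    have "?N {0<..<t} g \<le> ennreal M * (?N {0<..<t} f + Lq_norm q {0<..<t} (\<lambda>u. ?W u * ennreal (u / t * e)))"
      unfolding M_def P_def
    proof (rule Lq_norm_add_mult[OF q meas[OF f sub(1)] _ meas[OF g sub(1)] _ C])
      fix u assume "u \<in> {0<..<t}"
      with K(1) have "?W u * K_functional u g A0 A1 \<le> ?W u * (ennreal C * (K_functional u f A0 A1 + ennreal (u / t * e)))"
        by (intro mult_left_mono) auto
      then show "weighted_K \<theta> q b A0 A1 g u \<le> ennreal C * (weighted_K \<theta> q b A0 A1 f u + ?W u * ennreal (u / t * e))"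
        by (simp add: weighted_K_def distrib_left mult.left_commute)
    qed measurable
    also have "\<dots> \<le> ennreal M * (?N {0<..<t} f + ennreal (c1 * ?x))"
      by (intro mult_left_mono add_left_mono c1(2) t e) simp
    finally have S: "?N {0<..<t} g \<le> ennreal M * (?N {0<..<t} f + ennreal (c1 * ?x))" .
    have "?N {t<..} g \<le> Lq_norm q {t<..} (\<lambda>u. ?W u * ennreal e)"
      using K(2) by (intro Lq_norm_mono[OF q meas[OF g sub(2)]]) (auto simp: weighted_K_def intro!: mult_left_mono)
    also have "\<dots> \<le> ennreal (c2 * ?x)" by (rule c2(2)[OF t e])
    finally have T: "?N {t<..} g \<le> ennreal (c2 * ?x)" .
    have "?N {0<..} g \<le> ennreal P * (?N {0<..<t} g + ?N {t<..} g)"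
      using Lq_norm_split[OF q t meas[OF g order_refl]] by (simp add: P_def add.commute)
    also have "\<dots> \<le> ennreal P * (ennreal M * (?N {0<..<t} f + ennreal (c1 * ?x)) + ennreal (c2 * ?x))"
      by (intro mult_left_mono add_mono S T) simp
    also have "\<dots> \<le> ennreal (P * (M + M * c1 + c2)) * (?N {0<..<t} f + ennreal ?x)"
      using pos c1(1) c2(1) x by (intro ennreal_split_sum_le) auto
    finally show "?N {0<..} g \<le> ennreal (P * (M + M * c1 + c2)) * (?N {0<..<t} f + ennreal ?x)" .
  qed
qed

text \<open>
  The mirror image, applied to the component \<open>g = f1\<close>: the comparison with \<open>f\<close> now takes place
  above \<open>t\<close>.
\<close>

lemma weighted_K_norm_le_above:
  assumes A1: "quasi_normed_space A1" and q: "0 < q" and \<theta>: "0 < \<theta>" "\<theta> < 1"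
    and b: "slowly_varying b" and C: "0 < C"
  obtains c where "0 < c"
    "\<And>f g t e. f \<in> sum_space A0 A1 \<Longrightarrow> g \<in> sum_space A0 A1 \<Longrightarrow> 0 < t \<Longrightarrow> 0 \<le> e
      \<Longrightarrow> \<forall>u\<in>{t<..}. K_functional u g A0 A1 \<le> ennreal C * (K_functional u f A0 A1 + ennreal e)
      \<Longrightarrow> \<forall>u\<in>{0<..<t}. K_functional u g A0 A1 \<le> ennreal (u / t * e)
      \<Longrightarrow> Lq_norm q {0<..} (weighted_K \<theta> q b A0 A1 g)
        \<le> ennreal c * (Lq_norm q {t<..} (weighted_K \<theta> q b A0 A1 f) + ennreal (t powr (- \<theta>) * b t * e))"
proof -
  let ?W = "\<lambda>u. ennreal (u powr (- \<theta> - recip q) * b u)"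
  obtain c1 where c1: "0 < c1" "\<And>t e. 0 < t \<Longrightarrow> 0 \<le> e \<Longrightarrow>
      Lq_norm q {0<..<t} (\<lambda>u. ?W u * ennreal (u / t * e)) \<le> ennreal (c1 * (t powr (- \<theta>) * b t * e))"
    by (rule slowly_varying_weight_below[OF b q \<theta>(2)]) (rule that)
  obtain c2 where c2: "0 < c2" "\<And>t e. 0 < t \<Longrightarrow> 0 \<le> e \<Longrightarrow>
      Lq_norm q {t<..} (\<lambda>u. ?W u * ennreal e) \<le> ennreal (c2 * (t powr (- \<theta>) * b t * e))"
    by (rule slowly_varying_weight_above[OF b q \<theta>(1)]) (rule that)
  define P where "P = (2::real) powr (1 + recip q)"
  define M where "M = C * P"
  have pos: "0 < P" "0 < M" using C by (auto simp: P_def M_def)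
  note meas = measurable_weighted_K[OF b A1]
  show ?thesis
  proof (rule that[of "P * (M + M * c2 + c1)"])
    show "0 < P * (M + M * c2 + c1)"
      using pos c1(1) c2(1) by (intro mult_pos_pos add_pos_pos) auto
  next
    fix f g and t e :: real
    assume f: "f \<in> sum_space A0 A1" and g: "g \<in> sum_space A0 A1" and t: "0 < t" and e: "0 \<le> e"
      and K: "\<forall>u\<in>{t<..}. K_functional u g A0 A1 \<le> ennreal C * (K_functional u f A0 A1 + ennreal e)"
        "\<forall>u\<in>{0<..<t}. K_functional u g A0 A1 \<le> ennreal (u / t * e)"
    let ?x = "t powr (- \<theta>) * b t * e"
    let ?N = "\<lambda>S f. Lq_norm q S (weighted_K \<theta> q b A0 A1 f)"
    have x: "0 \<le> ?x" using e slowly_varying_pos[OF b t] by simp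
    have sub: "{t<..} \<subseteq> {0<..}" "{0<..<t} \<subseteq> {0<..}" using t by auto
    note [measurable] = measurable_weight[OF b sub(1), of "- \<theta> - recip q"]
    have "?N {t<..} g \<le> ennreal M * (?N {t<..} f + Lq_norm q {t<..} (\<lambda>u. ?W u * ennreal e))"
      unfolding M_def P_def
    proof (rule Lq_norm_add_mult[OF q meas[OF f sub(1)] _ meas[OF g sub(1)] _ C])
      fix u assume "u \<in> {t<..}"
      with K(1) have "?W u * K_functional u g A0 A1 \<le> ?W u * (ennreal C * (K_functional u f A0 A1 + ennreal e))"
        by (intro mult_left_mono) auto
      then show "weighted_K \<theta> q b A0 A1 g u \<le> ennreal C * (weighted_K \<theta> q b A0 A1 f u + ?W u * ennreal e)"
        by (simp add: weighted_K_def distrib_left mult.left_commute)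
    qed measurable
    also have "\<dots> \<le> ennreal M * (?N {t<..} f + ennreal (c2 * ?x))"
      by (intro mult_left_mono add_left_mono c2(2) t e) simp
    finally have S: "?N {t<..} g \<le> ennreal M * (?N {t<..} f + ennreal (c2 * ?x))" .
    have "?N {0<..<t} g \<le> Lq_norm q {0<..<t} (\<lambda>u. ?W u * ennreal (u / t * e))"
      using K(2) by (intro Lq_norm_mono[OF q meas[OF g sub(2)]]) (auto simp: weighted_K_def intro!: mult_left_mono)
    also have "\<dots> \<le> ennreal (c1 * ?x)" by (rule c1(2)[OF t e])
    finally have T: "?N {0<..<t} g \<le> ennreal (c1 * ?x)" .
    have "?N {0<..} g \<le> ennreal P * (?N {t<..} g + ?N {0<..<t} g)"
      using Lq_norm_split[OF q t meas[OF g order_refl]] by (simp add: P_def add.commute)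
    also have "\<dots> \<le> ennreal P * (ennreal M * (?N {t<..} f + ennreal (c2 * ?x)) + ennreal (c1 * ?x))"
      by (intro mult_left_mono add_mono S T) simp
    also have "\<dots> \<le> ennreal (P * (M + M * c2 + c1)) * (?N {t<..} f + ennreal ?x)"
      using pos c1(1) c2(1) x by (intro ennreal_split_sum_le) auto
    finally show "?N {0<..} g \<le> ennreal (P * (M + M * c2 + c1)) * (?N {t<..} f + ennreal ?x)" .
  qed
qed

text \<open>
  Below \<open>t\<close> the function \<open>K u f\<close> is at least \<open>u / t * K t f\<close>, and the weighted norm of this linear
  function is comparable to \<open>t powr (- \<theta>) * b t * K t f\<close>. Hence the error terms left over by a
  nearly optimal decomposition of \<open>f\<close> at \<open>t\<close> are absorbed by the first of the two weighted norms.
\<close>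

lemma K_functional_le_weighted_norm_below:
  assumes A0: "quasi_normed_space A0" and A1: "quasi_normed_space A1" and q: "0 < q"
    and \<theta>: "\<theta> < 1" and b: "slowly_varying b"
  obtains c where "0 < c"
    "\<And>f t. f \<in> sum_space A0 A1 \<Longrightarrow> 0 < t \<Longrightarrow>
      ennreal (t powr (- \<theta>) * b t) * K_functional t f A0 A1
      \<le> ennreal c * Lq_norm q {0<..<t} (weighted_K \<theta> q b A0 A1 f)"
proof -
  obtain c where c: "0 < c" "\<And>t e. 0 < t \<Longrightarrow> 0 \<le> e \<Longrightarrow> ennreal (t powr (- \<theta>) * b t * e)
      \<le> ennreal c * Lq_norm q {0<..<t} (\<lambda>u. ennreal (u powr (- \<theta> - recip q) * b u) * ennreal (u / t * e))"
    by (rule slowly_varying_weight_below[OF b q \<theta>]) (rule that)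
  show ?thesis
  proof (rule that[OF c(1)])
    fix f and t :: real assume f: "f \<in> sum_space A0 A1" and t: "0 < t"
    obtain e where e: "K_functional t f A0 A1 = ennreal e" "0 \<le> e"
      using K_functional_finite[OF f, of t] by (cases "K_functional t f A0 A1") auto
    have "ennreal (t powr (- \<theta>) * b t) * K_functional t f A0 A1 = ennreal (t powr (- \<theta>) * b t * e)"
      using e slowly_varying_pos[OF b t] by (simp flip: ennreal_mult)
    also have "\<dots> \<le> ennreal c * Lq_norm q {0<..<t} (\<lambda>u. ennreal (u powr (- \<theta> - recip q) * b u) * ennreal (u / t * e))"
      by (rule c(2)[OF t e(2)])
    also have "\<dots> \<le> ennreal c * Lq_norm q {0<..<t} (weighted_K \<theta> q b A0 A1 f)"
    proof (intro mult_left_mono Lq_norm_mono[OF q])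
      have [measurable]: "(\<lambda>u. ennreal (u powr (- \<theta> - recip q) * b u)) \<in> borel_measurable (lebesgue_on {0<..<t})"
        by (rule measurable_weight[OF b]) auto
      show "(\<lambda>u. ennreal (u powr (- \<theta> - recip q) * b u) * ennreal (u / t * e)) \<in> borel_measurable (lebesgue_on {0<..<t})"
        by measurable
      fix u assume u: "u \<in> {0<..<t}"
      then have "ennreal (u / t * e) \<le> K_functional u f A0 A1"
        using K_functional_quasiconcave[OF A0, of u t f A1] e by (simp flip: ennreal_mult'')
      then show "ennreal (u powr (- \<theta> - recip q) * b u) * ennreal (u / t * e) \<le> weighted_K \<theta> q b A0 A1 f u"
        unfolding weighted_K_def by (rule mult_left_mono) simp
    qed simp
    finally show "ennreal (t powr (- \<theta>) * b t) * K_functional t f A0 A1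
        \<le> ennreal c * Lq_norm q {0<..<t} (weighted_K \<theta> q b A0 A1 f)" .
  qed
qed

text \<open>
  An arbitrary decomposition of \<open>f\<close> in \<open>A0 + A1\<close> is used as a competitor for the \<open>K\<close>-functional
  of the interpolation spaces. Its cost \<open>e\<close> at \<open>t\<close> enters the estimate linearly, so
  the infimum over all decompositions replaces \<open>e\<close> by \<open>K t f\<close>, and
  \<open>K_functional_le_weighted_norm_below\<close> removes this term.
\<close>

lemma K_functional_interp_space_le_weighted_norms:
  fixes A0 A1 :: "'a::real_vector qspace"
  assumes A0: "quasi_normed_space A0" and A1: "quasi_normed_space A1" and q: "0 < q"
    and \<theta>: "0 < \<theta>" "\<theta> < 1"
    and b0: "slowly_varying b0" and b1: "slowly_varying b1"
  obtains c where "0 < c" "\<And>f t. f \<in> sum_space A0 A1 \<Longrightarrow> 0 < t \<Longrightarrow>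
    K_functional (b0 t / b1 t) f (interp_space \<theta> q b0 A0 A1) (interp_space \<theta> q b1 A0 A1)
    \<le> ennreal c * (Lq_norm q {0<..<t} (weighted_K \<theta> q b0 A0 A1 f)
      + ennreal (b0 t / b1 t) * Lq_norm q {t<..} (weighted_K \<theta> q b1 A0 A1 f))"
proof -
  obtain C where C: "0 < C" "\<And>u f g. 0 < u \<Longrightarrow>
      K_functional u (f + g) A0 A1 \<le> ennreal C * (K_functional u f A0 A1 + K_functional u g A0 A1)"
    by (rule K_functional_add[OF A0 A1]) (rule that)
  obtain c0 where c0: "0 < c0"
    "\<And>f g t e. f \<in> sum_space A0 A1 \<Longrightarrow> g \<in> sum_space A0 A1 \<Longrightarrow> 0 < t \<Longrightarrow> 0 \<le> e
      \<Longrightarrow> \<forall>u\<in>{0<..<t}. K_functional u g A0 A1 \<le> ennreal C * (K_functional u f A0 A1 + ennreal (u / t * e))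
      \<Longrightarrow> \<forall>u\<in>{t<..}. K_functional u g A0 A1 \<le> ennreal e
      \<Longrightarrow> Lq_norm q {0<..} (weighted_K \<theta> q b0 A0 A1 g)
        \<le> ennreal c0 * (Lq_norm q {0<..<t} (weighted_K \<theta> q b0 A0 A1 f) + ennreal (t powr (- \<theta>) * b0 t * e))"
    by (rule weighted_K_norm_le_below[OF A1 q \<theta> b0 C(1), where ?A0.0 = A0]) (rule that)
  obtain c1 where c1: "0 < c1"
    "\<And>f g t e. f \<in> sum_space A0 A1 \<Longrightarrow> g \<in> sum_space A0 A1 \<Longrightarrow> 0 < t \<Longrightarrow> 0 \<le> e
      \<Longrightarrow> \<forall>u\<in>{t<..}. K_functional u g A0 A1 \<le> ennreal C * (K_functional u f A0 A1 + ennreal e)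
      \<Longrightarrow> \<forall>u\<in>{0<..<t}. K_functional u g A0 A1 \<le> ennreal (u / t * e)
      \<Longrightarrow> Lq_norm q {0<..} (weighted_K \<theta> q b1 A0 A1 g)
        \<le> ennreal c1 * (Lq_norm q {t<..} (weighted_K \<theta> q b1 A0 A1 f) + ennreal (t powr (- \<theta>) * b1 t * e))"
    by (rule weighted_K_norm_le_above[OF A1 q \<theta> b1 C(1), where ?A0.0 = A0]) (rule that)
  obtain d where d: "0 < d" "\<And>f t. f \<in> sum_space A0 A1 \<Longrightarrow> 0 < t \<Longrightarrow>
      ennreal (t powr (- \<theta>) * b0 t) * K_functional t f A0 A1
      \<le> ennreal d * Lq_norm q {0<..<t} (weighted_K \<theta> q b0 A0 A1 f)"
    by (rule K_functional_le_weighted_norm_below[OF A0 A1 q \<theta>(2) b0]) (rule that)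
  define c where "c = c0 + c1"
  have c: "0 < c" "c0 \<le> c" "c1 \<le> c" using c0(1) c1(1) by (simp_all add: c_def)
  show ?thesis
  proof (rule that[of "c + 2 * c * d"])
    fix f :: 'a and t :: real assume f: "f \<in> sum_space A0 A1" and t: "0 < t"
    define r where "r = b0 t / b1 t"
    have bpos: "0 < b0 t" "0 < b1 t" using slowly_varying_pos t b0 b1 by blast+
    then have r: "0 < r" by (simp add: r_def)
    let ?W0 = "weighted_K \<theta> q b0 A0 A1" and ?W1 = "weighted_K \<theta> q b1 A0 A1"
    let ?K = "\<lambda>u f. K_functional u f A0 A1"
    let ?L = "K_functional r f (interp_space \<theta> q b0 A0 A1) (interp_space \<theta> q b1 A0 A1)"
    let ?I = "Lq_norm q {0<..<t} (?W0 f)" and ?J = "Lq_norm q {t<..} (?W1 f)"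
    let ?w = "t powr (- \<theta>) * b0 t"
    have w: "0 < ?w" "r * (t powr (- \<theta>) * b1 t) = ?w" using bpos t by (simp_all add: r_def)
    have "?L \<le> ennreal c * (?I + ennreal r * ?J) + ennreal (2 * c * ?w) * ?K t f"
    proof (rule K_functional_greatest_affine)
      fix f0 f1 assume f01: "f0 \<in> vecs A0" "f1 \<in> vecs A1" "f = f0 + f1"
      let ?e = "qnorm A0 f0 + t * qnorm A1 f1"
      have nonneg: "0 \<le> qnorm A0 f0" "0 \<le> qnorm A1 f1"
        using quasi_normed_space_nonneg A0 A1 f01 by blast+
      have e: "0 \<le> ?e" "qnorm A0 f0 \<le> ?e" "qnorm A1 f1 \<le> ?e / t"
        using nonneg t by (simp_all add: field_simps)
      have sums: "f0 \<in> sum_space A0 A1" "f1 \<in> sum_space A0 A1"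
        using f01 quasi_normed_space_zero(1)[OF A0] quasi_normed_space_zero(1)[OF A1]
        unfolding sum_space_def by (metis (mono_tags, lifting) add_0 add_0_right mem_Collect_eq)+
      \<comment> \<open>The bounds for \<open>- f0\<close> and \<open>- f1\<close> are there because \<open>f0 = f + (- f1)\<close> and \<open>f1 = f + (- f0)\<close>.\<close>
      have K0: "?K u f0 \<le> ennreal ?e" "?K u (- f0) \<le> ennreal ?e" for u
        using K_functional_le_left[OF A1, of _ A0 u] quasi_normed_space_uminus[OF A0 f01(1)] f01(1) e(2)
        by (metis ennreal_leI order_trans)+
      have K1: "?K u f1 \<le> ennreal (u / t * ?e)" "?K u (- f1) \<le> ennreal (u / t * ?e)" if "0 < u" for u
      proof -
        have "u * qnorm A1 f1 \<le> u / t * ?e" using mult_left_mono[OF e(3), of u] that by simp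
        then show "?K u f1 \<le> ennreal (u / t * ?e)" "?K u (- f1) \<le> ennreal (u / t * ?e)"
          using K_functional_le_right[OF A0, of _ A1 u] quasi_normed_space_uminus[OF A1 f01(2)] f01(2)
          by (metis ennreal_leI order_trans)+
      qed
      have N0: "Lq_norm q {0<..} (?W0 f0) \<le> ennreal c0 * (?I + ennreal (?w * ?e))"
      proof (rule c0(2)[OF f sums(1) t e(1)]; rule ballI)
        fix u assume "u \<in> {0<..<t}"
        then have u: "0 < u" by simp
        have "?K u f0 = ?K u (f + - f1)" using f01(3) by simp
        also have "\<dots> \<le> ennreal C * (?K u f + ?K u (- f1))" by (rule C(2)[OF u])
        also have "\<dots> \<le> ennreal C * (?K u f + ennreal (u / t * ?e))"
          by (intro mult_left_mono add_left_mono K1(2) u) simp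
        finally show "?K u f0 \<le> ennreal C * (?K u f + ennreal (u / t * ?e))" .
      qed (rule K0(1))
      have N1: "Lq_norm q {0<..} (?W1 f1) \<le> ennreal c1 * (?J + ennreal (t powr (- \<theta>) * b1 t * ?e))"
      proof (rule c1(2)[OF f sums(2) t e(1)]; rule ballI)
        fix u assume "u \<in> {t<..}"
        with t have u: "0 < u" by simp
        have "?K u f1 = ?K u (f + - f0)" using f01(3) by simp
        also have "\<dots> \<le> ennreal C * (?K u f + ?K u (- f0))" by (rule C(2)[OF u])
        also have "\<dots> \<le> ennreal C * (?K u f + ennreal ?e)"
          by (intro mult_left_mono add_left_mono K0(2)) simp
        finally show "?K u f1 \<le> ennreal C * (?K u f + ennreal ?e)" .
      qed (rule K1(1), simp)
      have "?L \<le> Lq_norm q {0<..} (?W0 f0) + ennreal r * Lq_norm q {0<..} (?W1 f1)"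
        unfolding f01(3) by (rule K_functional_interp_space_le[OF sums r])
      also have "\<dots> \<le> ennreal c * (?I + ennreal (?w * ?e))
          + ennreal r * (ennreal c * (?J + ennreal (t powr (- \<theta>) * b1 t * ?e)))"
        using c by (intro add_mono mult_left_mono order_trans[OF N0] order_trans[OF N1] mult_right_mono ennreal_leI) auto
      also have "ennreal r * (ennreal c * (?J + ennreal (t powr (- \<theta>) * b1 t * ?e)))
          = ennreal c * (ennreal r * ?J + ennreal (?w * ?e))"
      proof -
        have "ennreal r * ennreal (t powr (- \<theta>) * b1 t * ?e) = ennreal (?w * ?e)"
          using r w(2) by (metis ennreal_mult' less_imp_le mult.assoc)
        then show ?thesis by (simp add: distrib_left mult.left_commute)
      qed
      also have "ennreal c * (?I + ennreal (?w * ?e)) + ennreal c * (ennreal r * ?J + ennreal (?w * ?e))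
          = ennreal c * (?I + ennreal r * ?J) + ennreal (2 * c * ?w) * ennreal ?e"
      proof -
        have double: "ennreal (2 * c * v) * ennreal d = ennreal c * ennreal (v * d) + ennreal c * ennreal (v * d)"
          if "0 \<le> v" "0 \<le> d" for v d
          using c(1) that by (simp flip: ennreal_mult ennreal_plus)
        show ?thesis
          using double[OF less_imp_le[OF w(1)] e(1)] by (simp only: distrib_left ac_simps)
      qed
      finally show "?L \<le> ennreal c * (?I + ennreal r * ?J) + ennreal (2 * c * ?w) * ennreal ?e" .
    qed (use c w in simp)
    also have "ennreal (2 * c * ?w) * ?K t f = ennreal (2 * c) * (ennreal ?w * ?K t f)"
      using c w by (simp add: ennreal_mult mult.assoc)
    also have "\<dots> \<le> ennreal (2 * c) * (ennreal d * ?I)"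
      by (intro mult_left_mono d f t) simp
    also have "\<dots> \<le> ennreal (2 * c) * (ennreal d * (?I + ennreal r * ?J))"
      by (intro mult_left_mono) auto
    also have "ennreal c * (?I + ennreal r * ?J) + \<dots> = ennreal (c + 2 * c * d) * (?I + ennreal r * ?J)"
      using c d(1) by (simp add: ennreal_plus ennreal_mult distrib_right mult.assoc)
    finally have "?L \<le> ennreal (c + 2 * c * d) * (?I + ennreal r * ?J)" by (simp add: add_left_mono)
    then show "K_functional (b0 t / b1 t) f (interp_space \<theta> q b0 A0 A1) (interp_space \<theta> q b1 A0 A1)
      \<le> ennreal (c + 2 * c * d) * (?I + ennreal (b0 t / b1 t) * ?J)"
      by (simp only: r_def)
  qed (use c d in \<open>simp add: add_pos_pos\<close>)
qed

theorem theorem3p9: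
  fixes A0 A1 :: "'a::{topological_real_vector, t2_space} qspace"
    and \<theta> :: real and q :: ennreal and b0 b1 \<rho> :: "real \<Rightarrow> real"
  assumes "compatible_couple A0 A1"
    and "0 < \<theta>" "\<theta> < 1" and "0 < q"
    and "slowly_varying b0" "slowly_varying b1"
    and "\<rho> = (\<lambda>t. b0 t / b1 t)" and "mono_on {0<..} \<rho>"
  shows "\<exists>c>0. \<exists>c'>0. \<forall>f\<in>sum_space A0 A1. \<forall>t>0.
    (let L = K_functional (\<rho> t) f (interp_space \<theta> q b0 A0 A1) (interp_space \<theta> q b1 A0 A1);
         R = Lq_norm q {0<..<t} (weighted_K \<theta> q b0 A0 A1 f)
             + ennreal (\<rho> t) * Lq_norm q {t<..} (weighted_K \<theta> q b1 A0 A1 f)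
     in L \<le> ennreal c * R \<and> R \<le> ennreal c' * L)"
proof -
  have A: "quasi_normed_space A0" "quasi_normed_space A1"
    using assms(1) by (simp_all add: compatible_couple_def)
  obtain c where c: "0 < c" "\<And>f t. f \<in> sum_space A0 A1 \<Longrightarrow> 0 < t \<Longrightarrow>
      K_functional (b0 t / b1 t) f (interp_space \<theta> q b0 A0 A1) (interp_space \<theta> q b1 A0 A1)
      \<le> ennreal c * (Lq_norm q {0<..<t} (weighted_K \<theta> q b0 A0 A1 f)
        + ennreal (b0 t / b1 t) * Lq_norm q {t<..} (weighted_K \<theta> q b1 A0 A1 f))"
    by (rule K_functional_interp_space_le_weighted_norms[OF A assms(4) assms(2,3) assms(5,6)]) (rule that)
  obtain c' where c': "0 < c'" "\<And>f t. f \<in> sum_space A0 A1 \<Longrightarrow> 0 < t \<Longrightarrow>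
      Lq_norm q {0<..<t} (weighted_K \<theta> q b0 A0 A1 f)
        + ennreal (\<rho> t) * Lq_norm q {t<..} (weighted_K \<theta> q b1 A0 A1 f)
      \<le> ennreal c' * K_functional (\<rho> t) f (interp_space \<theta> q b0 A0 A1) (interp_space \<theta> q b1 A0 A1)"
    by (rule weighted_norms_le_K_functional_interp_space[OF A assms(4) assms(5-8)]) (rule that)
  show ?thesis
    unfolding Let_def using c c' assms(7) by (intro exI[of _ c] exI[of _ c'] conjI) auto
qed

end
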